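(* Let $0<a<1$ and let $f$ be a continuous map from $[0,1]$ onto itself such that (i) $f(0)=0=f(1)$ and $f(a)=1$, and (ii) $f$ is strictly increasing on $[0,a]$ and strictly decreasing on $[a,1]$. Then the following statements are equivalent: (a) $f$ has a dense orbit. (b) $f$ has dense periodic points (i.e. the set of periodic points of $f$ is dense in $[0,1]$). (c) $f$ has sensitive dependence on initial conditions; i.e., there exists a positive number $\delta$ such that for any point $x$ in $[0,1]$ and any open neighborhood $V$ of $x$ there exist a point $y$ in $V$ and a positive integer $n$ such that $|f^n(x)-f^n(y)|\ge\delta$. Furthermore, if $f$ has a dense orbit, then $f$ is topologically conjugate to the tent map $T(x)=1-|2x-1|$ on $[0,1]$, and $f$ has a dense (in $[0,1]$) uncountable invariant $1$-scrambled set which consists of transitive points.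
   Context: $f^n$ denotes the $n$-th iterate of $f$. The orbit of $c$ is $\{f^k(c) : k\ge 0\}$. A point is periodic if $f^m(c)=c$ for some $m\ge1$. A transitive point is a point whose orbit is dense in the space. For $\delta>0$, an uncountable set $S\subset [0,1]$ is a $\delta$-scrambled set of $f$ if (i) for any $x\neq y$ in $S$, $\limsup_{n\to\infty}|f^n(x)-f^n(y)|\ge\delta$ and $\liminf_{n\to\infty}|f^n(x)-f^n(y)|=0$; and (ii) for any $x\in S$ and any periodic point $p$ of $f$, $\limsup_{n\to\infty}|f^n(x)-f^n(p)|\ge\delta/2$. A set $S$ is invariant (under $f$) if $f(S)\subset S$. *)

theory Defs
  imports "HOL-Analysis.Analysis"
begin

text \<open>
  A self-map of \<^term>\<open>X\<close> is represented by a total function \<^term>\<open>f\<close> with \<^prop>\<open>f ` X \<subseteq> X\<close>;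
  its values outside \<^term>\<open>X\<close> play no role.
\<close>

definition orbit_of :: "('a \<Rightarrow> 'a) \<Rightarrow> 'a \<Rightarrow> 'a set"
  where "orbit_of f c = {(f ^^ k) c | k. k \<ge> 0}"

definition dense_in_set :: "'a::topological_space set \<Rightarrow> 'a set \<Rightarrow> bool"
  where "dense_in_set D X \<longleftrightarrow> D \<subseteq> X \<and> X \<subseteq> closure D"

definition periodic_points :: "('a \<Rightarrow> 'a) \<Rightarrow> 'a set \<Rightarrow> 'a set"
  where "periodic_points f X = {p \<in> X. \<exists>m\<ge>1. (f ^^ m) p = p}"

definition transitive_points :: "('a::topological_space \<Rightarrow> 'a) \<Rightarrow> 'a set \<Rightarrow> 'a set"
  where "transitive_points f X = {c \<in> X. dense_in_set (orbit_of f c) X}"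

definition has_dense_orbit :: "('a::topological_space \<Rightarrow> 'a) \<Rightarrow> 'a set \<Rightarrow> bool"
  where "has_dense_orbit f X \<longleftrightarrow> (\<exists>c\<in>X. dense_in_set (orbit_of f c) X)"

text \<open>Neighbourhoods are taken relative to \<^term>\<open>X\<close>.\<close>

definition sensitive_dependence :: "(real \<Rightarrow> real) \<Rightarrow> real set \<Rightarrow> bool"
  where "sensitive_dependence f X \<longleftrightarrow>
    (\<exists>\<delta>>0. \<forall>x\<in>X. \<forall>V. openin (top_of_set X) V \<and> x \<in> V \<longrightarrow>
      (\<exists>y\<in>V. \<exists>n\<ge>1. \<bar>(f ^^ n) x - (f ^^ n) y\<bar> \<ge> \<delta>))"

definition topologically_conjugate ::
    "'a::topological_space set \<Rightarrow> ('a \<Rightarrow> 'a) \<Rightarrow> 'b::topological_space set \<Rightarrow> ('b \<Rightarrow> 'b) \<Rightarrow> bool"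
  where "topologically_conjugate X f Y g \<longleftrightarrow>
    (\<exists>h k. homeomorphism X Y h k \<and> (\<forall>x\<in>X. h (f x) = g (h x)))"

definition tent_map :: "real \<Rightarrow> real"
  where "tent_map x = 1 - \<bar>2 * x - 1\<bar>"

definition invariant_set :: "('a \<Rightarrow> 'a) \<Rightarrow> 'a set \<Rightarrow> bool"
  where "invariant_set f S \<longleftrightarrow> f ` S \<subseteq> S"

text \<open>Limits superior and inferior are taken in \<^typ>\<open>ereal\<close>, where they always exist.\<close>

definition scrambled_set :: "real \<Rightarrow> (real \<Rightarrow> real) \<Rightarrow> real set \<Rightarrow> bool"
  where "scrambled_set \<delta> f S \<longleftrightarrow>
    \<delta> > 0 \<and> S \<subseteq> {0..1} \<and> uncountable S \<and>
    (\<forall>x\<in>S. \<forall>y\<in>S. x \<noteq> y \<longrightarrow>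
      limsup (\<lambda>n. ereal \<bar>(f ^^ n) x - (f ^^ n) y\<bar>) \<ge> ereal \<delta> \<and>
      liminf (\<lambda>n. ereal \<bar>(f ^^ n) x - (f ^^ n) y\<bar>) = 0) \<and>
    (\<forall>x\<in>S. \<forall>p\<in>periodic_points f {0..1}.
      limsup (\<lambda>n. ereal \<bar>(f ^^ n) x - (f ^^ n) p\<bar>) \<ge> ereal (\<delta> / 2))"

end

(*
  Every full unimodal map f is semiconjugate to the tent map T by a monotone continuous surjection h,
  the fixed point of the contraction that pulls a function back along the two branches. Everything
  hinges on whether h is injective. If h is constant on a nondegenerate interval J, then a dense orbit
  would return to J and project to a finite orbit of T; periodic points could not be dense, since at
  most one of the two preimages of a periodic orbit point of T is periodic; and sensitivity fails,
  because the iterates of J either lie in distinct fibers, whose lengths tend to 0, or end up in a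
  periodic fiber, on which some iterate of f is increasing. If h is injective it is a conjugacy, and
  it suffices to write down suitable binary expansions for T; since h fixes 0 and 1, distances
  close to 1 are preserved.
*)

theory Submission
  imports Defs
begin

subsection \<open>The tent map\<close>

text \<open>Invariance of the scrambled set shapes the choice of digits. An invariant set contains
  every shift of its points, so two shifts of one seed must separate just as two different seeds do,
  and yet all of them have to meet near 0. Offsets growing like \<open>k^2 * \<alpha>\<close> allow
  both: for different parameters their difference outgrows every fixed shift, and for equal
  parameters the shifts alone put one orbit on its digit 1 after the other has passed it. Blocks
  starting at cubes leave gaps of \<open>3*k^2 + 3*k + 1\<close> places, enough for an offset of at
  most \<open>2*k^2\<close> and for a run of zeros behind it that outlasts any fixed shift and any
  period. Half of the constant is demanded against a periodic point \<open>p\<close>. If the orbit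
  of \<open>p\<close> reaches \<open>1/2\<close>, the comparison is made while the scrambled point
  is near 0, at a time matching the phase of \<open>p\<close>; otherwise it is made while the
  scrambled point is near 1, where the phase is irrelevant.\<close>

text \<open>
  The distance to the nearest even integer: it folds the line onto \<open>[0, 1]\<close>, turning the doubling
  map into the tent map.
\<close>

definition tri_wave :: "real \<Rightarrow> real"
  where "tri_wave y = \<bar>y - 2 * of_int (round (y / 2))\<bar>"

lemma tri_wave_nonneg: "0 \<le> tri_wave y"
  by (simp add: tri_wave_def)

lemma tri_wave_le_1: "tri_wave y \<le> 1"
  using of_int_round_abs_le[of "y/2"] unfolding tri_wave_def by linarith

lemma tri_wave_in: "tri_wave y \<in> {0..1}"
  using tri_wave_nonneg tri_wave_le_1 by simp

text \<open>Any other even integer is at least 2 away from the nearest one, hence at least 1 away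
  from \<open>y\<close>.\<close>

lemma tri_wave_le: "tri_wave y \<le> \<bar>y - 2 * of_int j\<bar>"
proof (cases "round (y / 2) = j")
  case False
  hence "1 \<le> \<bar>round (y/2) - j\<bar>" by linarith
  hence "1 \<le> \<bar>of_int (round (y/2)) - of_int j :: real\<bar>" by linarith
  thus ?thesis using of_int_round_abs_le[of "y/2"] unfolding tri_wave_def by linarith
qed (simp add: tri_wave_def)

lemma tri_wave_eq:
  assumes "\<bar>y - 2 * of_int j\<bar> \<le> 1"
  shows "tri_wave y = \<bar>y - 2 * of_int j\<bar>"
proof (cases "round (y / 2) = j")
  case False
  hence "1 \<le> \<bar>round (y/2) - j\<bar>" by linarith
  hence "1 \<le> \<bar>of_int (round (y/2)) - of_int j :: real\<bar>" by linarith
  thus ?thesis using of_int_round_abs_le[of "y/2"] assms unfolding tri_wave_def by linarith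
qed (simp add: tri_wave_def)

lemma tri_wave_id: "y \<in> {0..1} \<Longrightarrow> tri_wave y = y"
  using tri_wave_eq[of y 0] by simp

lemma tri_wave_add_even:
  assumes "e / 2 \<in> \<int>"
  shows "tri_wave (y + e) = tri_wave y"
proof -
  obtain j where j: "e = 2 * of_int j"
    using assms by (metis Ints_cases nonzero_eq_divide_eq mult.commute zero_neq_numeral)
  have "\<bar>(y + e) - 2 * of_int (round (y/2) + j)\<bar> \<le> 1"
    using tri_wave_le_1[of y] by (simp add: tri_wave_def j)
  from tri_wave_eq[OF this] show ?thesis by (simp add: tri_wave_def j)
qed

lemma tri_wave_even: "e / 2 \<in> \<int> \<Longrightarrow> tri_wave e = 0"
  using tri_wave_add_even[of e 0] tri_wave_id[of 0] by simp

lemma tri_wave_odd: "e / 2 \<in> \<int> \<Longrightarrow> tri_wave (1 + e) = 1"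
  using tri_wave_add_even[of e 1] tri_wave_id[of 1] by simp

lemma tri_wave_double: "tri_wave (2 * y) = tent_map (tri_wave y)"
proof -
  define j where "j = round (y/2)"
  define w where "w = y - 2 * of_int j"
  have w: "\<bar>w\<bar> \<le> 1" and D: "tri_wave y = \<bar>w\<bar>"
    using tri_wave_le_1[of y] by (simp_all add: tri_wave_def w_def j_def)
  have y: "y = w + 2 * of_int j" by (simp add: w_def)
  \<comment> \<open>The even integer nearest to \<open>2 * y\<close> is \<open>4*j\<close>,
    \<open>4*j + 2\<close> or \<open>4*j - 2\<close>; the last two cases give the decreasing
    branch.\<close>
  consider "\<bar>w\<bar> \<le> 1/2" | "w > 1/2" | "w < -1/2" by linarith
  thus ?thesis
  proof cases
    case 1
    hence "tri_wave (2*y) = \<bar>2*w\<bar>" using tri_wave_eq[of "2*y" "2*j"] by (simp add: y)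
    thus ?thesis unfolding D tent_map_def using 1 by linarith
  next
    case 2
    hence "tri_wave (2*y) = \<bar>2*w - 2\<bar>" using tri_wave_eq[of "2*y" "2*j+1"] w by (simp add: y)
    thus ?thesis unfolding D tent_map_def using 2 w by linarith
  next
    case 3
    hence "tri_wave (2*y) = \<bar>2*w + 2\<bar>" using tri_wave_eq[of "2*y" "2*j-1"] w by (simp add: y)
    thus ?thesis unfolding D tent_map_def using 3 w by linarith
  qed
qed

lemma tent_funpow: "(tent_map ^^ n) (tri_wave y) = tri_wave (2 ^ n * y)"
  by (induction n) (simp_all add: tri_wave_double[symmetric] mult.assoc)

text \<open>As for any distance to a set: each point is measured against the even integer nearest to
  the other.\<close>

lemma tri_wave_lipschitz: "\<bar>tri_wave y - tri_wave z\<bar> \<le> \<bar>y - z\<bar>"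
  using tri_wave_le[of y "round (z/2)"] tri_wave_le[of z "round (y/2)"]
  unfolding tri_wave_def by linarith

text \<open>Scaled by \<open>2 ^ n\<close>, the interval is longer than 3. An even integer then lies
  less than 2 beyond its left end, the next odd one less than 3 beyond, and folding sends them to 0
  and 1.\<close>

lemma tent_maps_onto:
  assumes "0 \<le> u" "u < v" "v \<le> 1"
  obtains n y z where "n \<ge> 1" "y \<in> {u..v}" "z \<in> {u..v}" "(tent_map ^^ n) y = 0" "(tent_map ^^ n) z = 1"
proof -
  obtain n where "3 / (v - u) < 2 ^ n" using real_arch_pow[of 2] by force
  hence n: "3 < 2 ^ n * (v - u)" using assms by (simp add: field_simps)
  define j where "j = \<lceil>2 ^ n * u / 2\<rceil>"
  define y :: real where "y = (2 * of_int j) / 2 ^ n"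
  define z :: real where "z = (2 * of_int j + 1) / 2 ^ n"
  have j: "2 ^ n * u \<le> 2 * of_int j" "2 * of_int j < 2 ^ n * u + 2"
    unfolding j_def by linarith+
  have n1: "n \<ge> 1" using n assms by (cases n) auto
  have yz: "u \<le> y" "y \<le> v" "u \<le> z" "z \<le> v"
    using j n by (simp_all add: y_def z_def field_simps)
  hence "y \<in> {0..1}" "z \<in> {0..1}" using assms by auto
  have Ty: "(tent_map ^^ n) y = tri_wave (2 ^ n * y)" if "y \<in> {0..1}" for y
    using tent_funpow[of n y] tri_wave_id[OF that] by simp
  show thesis
  proof
    show "(tent_map ^^ n) y = 0" "(tent_map ^^ n) z = 1"
      using Ty[of y] Ty[of z] \<open>y \<in> {0..1}\<close> \<open>z \<in> {0..1}\<close>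
        tri_wave_even[of "2 * of_int j"] tri_wave_odd[of "2 * of_int j"]
      by (simp_all add: y_def z_def add.commute)
  qed (use n1 yz in auto)
qed

text \<open>The points \<open>x = 2 * j / (2 ^ n - 1)\<close> solve
  \<open>2 ^ n * x = x + 2 * j\<close>, so folding makes them periodic; their spacing
  \<open>2 / (2 ^ n - 1)\<close> tends to 0.\<close>

lemma tent_periodic_approx:
  assumes y: "y \<in> {0..1}" and "0 < \<epsilon>"
  obtains x m where "x \<in> {0..1}" "\<bar>x - y\<bar> < \<epsilon>" "m \<ge> 1" "(tent_map ^^ m) x = x"
proof -
  obtain n where "2 / \<epsilon> + 1 < 2 ^ n" using real_arch_pow[of 2] by force
  hence n: "2 / \<epsilon> < 2 ^ n - 1" by linarith
  moreover have "0 < 2 / \<epsilon>" using assms by simp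
  ultimately have pos: "(0::real) < 2 ^ n - 1" by linarith
  hence n1: "n \<ge> 1" by (cases n) auto
  define j where "j = \<lfloor>y * (2 ^ n - 1) / 2\<rfloor>"
  define x :: real where "x = 2 * of_int j / (2 ^ n - 1)"
  have j: "2 * of_int j \<le> y * (2 ^ n - 1)" "y * (2 ^ n - 1) < 2 * of_int j + 2" "0 \<le> j"
    using y pos unfolding j_def by (linarith, linarith, simp)
  have xy: "x \<le> y" using j(1) pos by (simp add: x_def pos_divide_le_eq)
  have x0: "0 \<le> x" using j pos by (simp add: x_def)
  have "y < (2 * of_int j + 2) / (2 ^ n - 1)" using j(2) pos by (simp add: pos_less_divide_eq)
  hence "y - x < 2 / (2 ^ n - 1)" by (simp add: x_def add_divide_distrib)
  also have "\<dots> < \<epsilon>" using n pos assms by (simp add: field_simps)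
  finally have d: "\<bar>x - y\<bar> < \<epsilon>" using xy by simp
  have x: "x \<in> {0..1}" using x0 xy y by simp
  have "2 ^ n * x = x + 2 * of_int j" using pos by (simp add: x_def field_simps)
  hence "(tent_map ^^ n) x = x"
    using tent_funpow[of n x] tri_wave_id[OF x] tri_wave_add_even[of "2 * of_int j" x] by simp
  thus thesis using that x d n1 by blast
qed

lemma tent_map_in: "x \<in> {0..1} \<Longrightarrow> tent_map x \<in> {0..1}"
  by (auto simp: tent_map_def)

lemma tent_funpow_in: "x \<in> {0..1} \<Longrightarrow> (tent_map ^^ n) x \<in> {0..1}"
  by (induction n) (simp_all add: tent_map_in del: atLeastAtMost_iff)

lemma tent_funpow_half: "1 \<le> n \<Longrightarrow> (tent_map ^^ n) (1/2) \<in> {0, 1}"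
  by (induction n rule: nat_induct_at_least) (auto simp: tent_map_def)

text \<open>Otherwise \<open>1/2\<close> would itself be periodic, but it is sent to 1, then to 0,
  and stays there. Along a periodic orbit the choice of branch is therefore never ambiguous.\<close>

lemma tent_periodic_neq_half:
  assumes "(tent_map ^^ m) s = s" "1 \<le> m"
  shows "(tent_map ^^ i) s \<noteq> 1/2"
proof
  assume i: "(tent_map ^^ i) s = 1/2"
  have "(tent_map ^^ m) ((tent_map ^^ i) s) = (tent_map ^^ i) ((tent_map ^^ m) s)"
    by (metis add.commute comp_apply funpow_add)
  thus False using tent_funpow_half[OF assms(2)] by (simp add: i assms(1))
qed

subsection \<open>Orbits of the tent map with prescribed digits\<close>

text \<open>
  A seed is the number whose binary expansion carries, from position \<open>k\<^sup>3\<close> on, first the \<open>k\<close>-th word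
  of an enumeration of all finite words (this makes the orbit dense) and then a single digit 1 at
  offset \<open>\<lfloor>k\<^sup>2 \<alpha>\<rfloor>\<close>, surrounded by long blocks of zeros. For different parameters \<open>\<alpha>\<close> these offsets
  drift apart, so one orbit gets near 1 while the other is still near 0.
\<close>

definition seed_word :: "nat \<Rightarrow> real" where
  "seed_word k = (case prod_decode k of (K, j) \<Rightarrow> if j \<le> 2 ^ K then real j / 2 ^ K else 0)"

definition seed_pos :: "real \<Rightarrow> nat \<Rightarrow> nat" where
  "seed_pos \<alpha> k = nat \<lfloor>real k ^ 2 * \<alpha>\<rfloor>"

definition seed_coeff :: "real \<Rightarrow> nat \<Rightarrow> real" where
  "seed_coeff \<alpha> k = seed_word k + 1 / 2 ^ seed_pos \<alpha> k"

definition seed_sum :: "real \<Rightarrow> real" where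
  "seed_sum \<alpha> = (\<Sum>k. seed_coeff \<alpha> k / 2 ^ (k ^ 3))"

text \<open>The sum leaves \<open>[0, 1]\<close>, since its term for \<open>k = 0\<close> is at
  least 1; by \<open>tent_funpow\<close> the folded number still has its orbit given by the digits
  of the sum.\<close>

definition seed :: "real \<Rightarrow> real" where
  "seed \<alpha> = tri_wave (seed_sum \<alpha>)"

lemma seed_word_bounds: "0 \<le> seed_word k" "seed_word k \<le> 1"
  by (auto simp: seed_word_def field_simps split: prod.split)

lemma self_le_power2_nat: "k \<le> (k::nat)\<^sup>2"
  by (simp add: power2_eq_square)

lemma prod_decode_fst_le: "fst (prod_decode k) \<le> k"
  by (metis prod.collapse prod_decode_inverse le_prod_encode_1)

text \<open>The \<open>k\<close>-th word has at most \<open>k\<close> binary digits, because the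
  first component of \<open>prod_decode k\<close> is at most \<open>k\<close>. Shifted further than
  that, it is an even integer and disappears under folding.\<close>

lemma seed_word_even:
  assumes "k < m"
  shows "2 ^ m * seed_word k / 2 \<in> \<int>"
proof -
  obtain K j where Kj: "prod_decode k = (K, j)" by fastforce
  hence "K \<le> k" using prod_decode_fst_le[of k] by simp
  then obtain d where d: "m = K + Suc d" using assms by (metis add_Suc_right le_imp_less_Suc less_imp_Suc_add order_le_less_trans)
  have "2 ^ m * (real j / 2 ^ K) / 2 = of_int (2 ^ d * int j)" by (simp add: d power_add)
  hence "2 ^ m * (real j / 2 ^ K) / 2 \<in> \<int>" by (metis Ints_of_int)
  thus ?thesis by (auto simp: seed_word_def Kj)
qed

text \<open>The reason for parameters in \<open>[1, 2]\<close>: the digit 1 then stands behind the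
  word (for \<open>k \<ge> 2\<close>) and well before the next cube.\<close>

lemma seed_pos_bounds:
  assumes "\<alpha> \<in> {1..2}"
  shows "k\<^sup>2 \<le> seed_pos \<alpha> k" "seed_pos \<alpha> k \<le> 2 * k\<^sup>2"
proof -
  have "real k ^ 2 * 1 \<le> real k ^ 2 * \<alpha>" "real k ^ 2 * \<alpha> \<le> real k ^ 2 * 2"
    using assms by (intro mult_left_mono; simp)+
  hence "of_int (int (k\<^sup>2)) \<le> real k ^ 2 * \<alpha>" "real k ^ 2 * \<alpha> < of_int (int (2 * k\<^sup>2)) + 1"
    by auto
  hence "int (k\<^sup>2) \<le> \<lfloor>real k ^ 2 * \<alpha>\<rfloor>" "\<lfloor>real k ^ 2 * \<alpha>\<rfloor> \<le> int (2 * k\<^sup>2)"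
    by (linarith)+
  thus "k\<^sup>2 \<le> seed_pos \<alpha> k" "seed_pos \<alpha> k \<le> 2 * k\<^sup>2"
    unfolding seed_pos_def by linarith+
qed

lemma seed_coeff_bounds: "0 \<le> seed_coeff \<alpha> k" "seed_coeff \<alpha> k \<le> 2"
proof -
  have "1 / 2 ^ seed_pos \<alpha> k \<le> (1::real)" "0 \<le> 1 / (2::real) ^ seed_pos \<alpha> k" by simp_all
  thus "0 \<le> seed_coeff \<alpha> k" "seed_coeff \<alpha> k \<le> 2"
    using seed_word_bounds[of k] unfolding seed_coeff_def by linarith+
qed

lemma seed_coeff_even:
  assumes "k < m" "seed_pos \<alpha> k < m"
  shows "2 ^ m * seed_coeff \<alpha> k / 2 \<in> \<int>"
proof -
  obtain d where d: "m = seed_pos \<alpha> k + Suc d" using assms(2) less_imp_Suc_add by fastforce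
  have "2 ^ m * (1 / 2 ^ seed_pos \<alpha> k) / 2 = (of_int (2 ^ d) :: real)"
    by (simp add: d power_add)
  hence "2 ^ m * (1 / 2 ^ seed_pos \<alpha> k) / (2::real) \<in> \<int>" by (metis Ints_of_int)
  from Ints_add[OF seed_word_even[OF assms(1)] this] show ?thesis
    by (simp add: seed_coeff_def distrib_left add_divide_distrib)
qed

lemma cube_gap: "n < k \<Longrightarrow> (n::nat) ^ 3 + 3 * n\<^sup>2 + 3 * n + 1 \<le> k ^ 3"
proof -
  assume "n < k"
  hence "(n + 1) ^ 3 \<le> k ^ 3" by (intro power_mono) auto
  thus ?thesis by (simp add: eval_nat_numeral algebra_simps)
qed

text \<open>The cubes grow by at least 1 per step and the coefficients are at most 2, so a geometric
  series of ratio \<open>1/2\<close> dominates.\<close>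

lemma seed_tail:
  fixes \<alpha> :: real and k :: nat
  defines "c \<equiv> \<lambda>n. seed_coeff \<alpha> (n + Suc k) / 2 ^ ((n + Suc k) ^ 3)"
  shows "summable c" "0 \<le> suminf c" "suminf c \<le> 4 / 2 ^ (Suc k ^ 3)"
proof -
  define g :: "nat \<Rightarrow> real" where "g n = 2 / 2 ^ (Suc k ^ 3) * (1/2) ^ n" for n
  have g: "g sums (2 / 2 ^ (Suc k ^ 3) * (1 / (1 - 1/2)))"
    unfolding g_def by (intro sums_mult geometric_sums) simp
  have c0: "0 \<le> c n" for n using seed_coeff_bounds by (simp add: c_def)
  have cg: "c n \<le> g n" for n
  proof -
    have "Suc k ^ 3 + n \<le> (n + Suc k) ^ 3" by (simp add: eval_nat_numeral algebra_simps)
    hence "(2::real) ^ (Suc k ^ 3 + n) \<le> 2 ^ ((n + Suc k) ^ 3)" by (intro power_increasing) auto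
    hence "c n \<le> 2 / 2 ^ (Suc k ^ 3 + n)"
      unfolding c_def by (intro frac_le seed_coeff_bounds) auto
    thus ?thesis by (simp add: g_def power_add power_divide)
  qed
  show s: "summable c"
    by (rule summable_comparison_test'[OF sums_summable[OF g], of 0]) (use c0 cg in auto)
  show "0 \<le> suminf c" using s c0 by (intro suminf_nonneg) auto
  have "suminf c \<le> suminf g" using s g cg by (intro suminf_le) (auto intro: sums_summable)
  thus "suminf c \<le> 4 / 2 ^ (Suc k ^ 3)" using sums_unique[OF g] by simp
qed

text \<open>Only block \<open>k\<close> is visible at these times. Earlier blocks have become even
  integers, and since \<open>s \<le> 2 * k\<^sup>2 + 2 * k\<close> leaves at least
  \<open>k + 1\<close> places before the next cube, later blocks contribute at most
  \<open>4 / 2 ^ (k + 1)\<close>.\<close>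

lemma seed_orbit:
  assumes \<alpha>: "\<alpha> \<in> {1..2}" and s: "s \<le> 2 * k\<^sup>2 + 2 * k"
  shows "\<bar>(tent_map ^^ (k ^ 3 + s)) (seed \<alpha>) - tri_wave (2 ^ s * seed_coeff \<alpha> k)\<bar> \<le> 2 * (1/2) ^ k"
proof -
  define c where "c n = seed_coeff \<alpha> n / 2 ^ (n ^ 3)" for n
  define P :: real where "P = 2 ^ (k ^ 3 + s)"
  define R where "R = (\<Sum>n. c (n + Suc k))"
  have R: "summable (\<lambda>n. c (n + Suc k))" "0 \<le> R" "R \<le> 4 / 2 ^ (Suc k ^ 3)"
    unfolding R_def c_def using seed_tail by auto
  have "summable c" using R(1) by (subst (asm) summable_iff_shift)
  hence split: "seed_sum \<alpha> = R + (sum c {..<k} + c k)"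
    unfolding seed_sum_def R_def c_def[symmetric] by (subst suminf_split_initial_segment[of c "Suc k"]) auto
  have "P * c n / 2 \<in> \<int>" if "n < k" for n
  proof -
    have gap: "n ^ 3 + 3 * n\<^sup>2 + 3 * n + 1 \<le> k ^ 3" using that by (rule cube_gap)
    define m where "m = k ^ 3 + s - n ^ 3"
    have m: "k ^ 3 + s = n ^ 3 + m" "n < m" "seed_pos \<alpha> n < m"
      using gap seed_pos_bounds[OF \<alpha>, of n] by (auto simp: m_def)
    have "P * c n = 2 ^ m * seed_coeff \<alpha> n" by (simp add: P_def c_def m(1) power_add)
    thus ?thesis using seed_coeff_even[OF m(2,3)] by simp
  qed
  hence "P * sum c {..<k} / 2 \<in> \<int>"
    by (auto simp: sum_distrib_left sum_divide_distrib intro!: Ints_sum)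
  hence "tri_wave ((P * R + P * c k) + P * sum c {..<k}) = tri_wave (P * R + P * c k)"
    by (rule tri_wave_add_even)
  hence "(tent_map ^^ (k ^ 3 + s)) (seed \<alpha>) = tri_wave (P * R + P * c k)"
    by (simp add: seed_def tent_funpow split P_def algebra_simps)
  moreover have "P * c k = 2 ^ s * seed_coeff \<alpha> k" by (simp add: P_def c_def power_add)
  moreover have "\<bar>tri_wave (P * R + P * c k) - tri_wave (P * c k)\<bar> \<le> P * R"
    using tri_wave_lipschitz[of "P * R + P * c k" "P * c k"] R(2) by (simp add: P_def)
  moreover have "P * R \<le> 2 * (1/2) ^ k"
  proof -
    have "k ^ 3 + s + k + 1 \<le> Suc k ^ 3" using s by (simp add: eval_nat_numeral algebra_simps)
    hence "(2::real) ^ (k ^ 3 + s + k + 1) \<le> 2 ^ (Suc k ^ 3)" by (intro power_increasing) auto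
    hence "4 / 2 ^ (Suc k ^ 3) \<le> 4 / (2::real) ^ (k ^ 3 + s + k + 1)" by (intro divide_left_mono) auto
    hence "P * R \<le> P * (4 / 2 ^ (k ^ 3 + s + k + 1))"
      using R(3) by (intro mult_left_mono) (auto simp: P_def)
    thus ?thesis by (simp add: P_def power_add power_divide)
  qed
  ultimately show ?thesis by simp
qed

lemma tendsto_half_power: "(\<lambda>k. 2 * (1/2) ^ k :: real) \<longlonglongrightarrow> 0"
  using tendsto_mult_right_zero[OF LIMSEQ_realpow_zero[of "1/2"]] by simp

text \<open>Once the shift passes the digit 1, block \<open>k\<close> too is an even integer, and
  only the error from later blocks remains.\<close>

lemma seed_tendsto_0:
  assumes \<alpha>: "\<alpha> \<in> {1..2}"
    and s: "eventually (\<lambda>k. seed_pos \<alpha> k < s k \<and> s k \<le> 2 * k\<^sup>2 + 2 * k) sequentially"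
  shows "(\<lambda>k. (tent_map ^^ (k ^ 3 + s k)) (seed \<alpha>)) \<longlonglongrightarrow> 0"
proof (rule Lim_null_comparison[OF _ tendsto_half_power], use s in eventually_elim)
  case (elim k)
  have "k \<le> k\<^sup>2" by (rule self_le_power2_nat)
  hence "k < s k" using seed_pos_bounds(1)[OF \<alpha>, of k] elim by linarith
  hence "tri_wave (2 ^ s k * seed_coeff \<alpha> k) = 0" using elim by (intro tri_wave_even seed_coeff_even) auto
  thus ?case using seed_orbit[OF \<alpha>, of "s k" k] elim by simp
qed

text \<open>Shifted by exactly its offset, the digit 1 becomes the units digit, while the word has
  become an even integer.\<close>

lemma seed_tendsto_1:
  assumes \<alpha>: "\<alpha> \<in> {1..2}"
  shows "(\<lambda>k. (tent_map ^^ (k ^ 3 + seed_pos \<alpha> k)) (seed \<alpha>)) \<longlonglongrightarrow> 1"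
proof (rule LIM_zero_cancel, rule Lim_null_comparison[OF _ tendsto_half_power],
    use eventually_ge_at_top[of 2] in eventually_elim)
  case (elim k)
  \<comment> \<open>For \<open>k \<ge> 2\<close> this makes the offset strictly larger than
    \<open>k\<close>, as \<open>seed_word_even\<close> requires.\<close>
  have "2 * k \<le> k\<^sup>2" using elim by (simp add: power2_eq_square)
  hence "k < seed_pos \<alpha> k" using seed_pos_bounds(1)[OF \<alpha>, of k] elim by linarith
  hence "tri_wave (1 + 2 ^ seed_pos \<alpha> k * seed_word k) = 1" by (intro tri_wave_odd seed_word_even)
  moreover have "2 ^ seed_pos \<alpha> k * seed_coeff \<alpha> k = 1 + 2 ^ seed_pos \<alpha> k * seed_word k"
    by (simp add: seed_coeff_def distrib_left)
  ultimately show ?case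
    using seed_orbit[OF \<alpha>, of "seed_pos \<alpha> k" k] seed_pos_bounds(2)[OF \<alpha>, of k] by simp
qed

text \<open>At time \<open>k ^ 3\<close> the orbit shadows the \<open>k\<close>-th word, and the
  binary truncations of \<open>y\<close> occur among the words. Times tending to infinity make every
  shift of the seed transitive as well.\<close>

lemma seed_transitive:
  assumes \<alpha>: "\<alpha> \<in> {1..2}" and y: "y \<in> {0..1}"
  obtains \<sigma> where "filterlim \<sigma> at_top sequentially" "(\<lambda>k. (tent_map ^^ \<sigma> k) (seed \<alpha>)) \<longlonglongrightarrow> y"
proof
  define j where "j K = nat \<lfloor>y * 2 ^ K\<rfloor>" for K
  define \<tau> where "\<tau> K = prod_encode (K, j K)" for K
  have \<tau>: "K \<le> \<tau> K" for K by (simp add: \<tau>_def le_prod_encode_1)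
  hence \<tau>_lim: "filterlim \<tau> at_top sequentially"
    by (intro filterlim_at_top_mono[OF filterlim_ident]) auto
  have "K \<le> \<tau> K ^ 3" for K
  proof (cases "K = 0")
    case False
    have "\<tau> K ^ 1 \<le> \<tau> K ^ 3" using \<tau>[of K] False by (intro power_increasing) auto
    thus ?thesis using \<tau>[of K] by simp
  qed simp
  thus "filterlim (\<lambda>K. \<tau> K ^ 3) at_top sequentially"
    by (intro filterlim_at_top_mono[OF filterlim_ident]) auto
  have "(\<lambda>k. (tent_map ^^ (k ^ 3)) (seed \<alpha>) - seed_word k) \<longlonglongrightarrow> 0"
  proof (rule Lim_null_comparison[OF always_eventually])
    show "(\<lambda>k. 2 * (1/2) ^ k + (1/2) ^ k :: real) \<longlonglongrightarrow> 0"
      using tendsto_add[OF tendsto_half_power LIMSEQ_realpow_zero[of "1/2"]] by simp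
    show "\<forall>k. norm ((tent_map ^^ (k ^ 3)) (seed \<alpha>) - seed_word k) \<le> 2 * (1/2) ^ k + (1/2) ^ k"
    proof
      fix k :: nat
      have "k \<le> k\<^sup>2" by (rule self_le_power2_nat)
      hence "k \<le> seed_pos \<alpha> k" using seed_pos_bounds(1)[OF \<alpha>, of k] by linarith
      hence "(1/2) ^ seed_pos \<alpha> k \<le> (1/2 :: real) ^ k" by (intro power_decreasing) auto
      hence "\<bar>seed_coeff \<alpha> k - seed_word k\<bar> \<le> (1/2) ^ k"
        by (simp add: seed_coeff_def power_divide)
      moreover have "tri_wave (seed_word k) = seed_word k"
        using seed_word_bounds by (intro tri_wave_id) auto
      ultimately show "norm ((tent_map ^^ (k ^ 3)) (seed \<alpha>) - seed_word k) \<le> 2 * (1/2) ^ k + (1/2) ^ k"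
        using seed_orbit[OF \<alpha>, of 0 k] tri_wave_lipschitz[of "seed_coeff \<alpha> k" "seed_word k"] by simp
    qed
  qed
  from filterlim_compose[OF this \<tau>_lim]
  have "(\<lambda>K. (tent_map ^^ (\<tau> K ^ 3)) (seed \<alpha>) - seed_word (\<tau> K)) \<longlonglongrightarrow> 0" by (simp add: o_def)
  moreover have "(\<lambda>K. seed_word (\<tau> K)) \<longlonglongrightarrow> y"
  proof (rule LIM_zero_cancel, rule Lim_null_comparison[OF always_eventually LIMSEQ_realpow_zero[of "1/2"]])
    show "\<forall>K. norm (seed_word (\<tau> K) - y) \<le> (1/2) ^ K"
    proof
      fix K
      have "0 \<le> y * 2 ^ K" "y * 2 ^ K \<le> 2 ^ K" using y by (auto simp: mult_left_le_one_le)
      hence j: "real (j K) \<le> y * 2 ^ K" "y * 2 ^ K < real (j K) + 1" "real (j K) \<le> 2 ^ K"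
        unfolding j_def by linarith+
      hence "j K \<le> 2 ^ K" by (metis of_nat_le_iff of_nat_numeral of_nat_power)
      hence w: "seed_word (\<tau> K) = real (j K) / 2 ^ K" by (simp add: seed_word_def \<tau>_def)
      have "seed_word (\<tau> K) \<le> y" "y < (real (j K) + 1) / 2 ^ K"
        using j(1,2) by (simp_all add: w pos_divide_le_eq pos_less_divide_eq)
      hence "seed_word (\<tau> K) - y \<le> 0" "y - seed_word (\<tau> K) \<le> (1/2) ^ K"
        by (simp_all add: w add_divide_distrib power_divide)
      thus "norm (seed_word (\<tau> K) - y) \<le> (1/2) ^ K" by simp
    qed
  qed auto
  ultimately show "(\<lambda>K. (tent_map ^^ (\<tau> K ^ 3)) (seed \<alpha>)) \<longlonglongrightarrow> y"
    using Lim_transform by fastforce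
qed

lemma filterlim_cube_add: "filterlim (\<lambda>k. k ^ 3 + s k :: nat) at_top sequentially"
proof (rule filterlim_at_top_mono[OF filterlim_ident always_eventually], rule allI)
  fix k :: nat
  show "k \<le> k ^ 3 + s k" by (simp add: eval_nat_numeral trans_le_add1)
qed

text \<open>These times lie behind the digit 1 for every admissible parameter, and a fixed
  \<open>l\<close> is eventually absorbed by the remaining \<open>2 * k - 1\<close> places. All
  seeds and all their shifts thus share them.\<close>

lemma seed_common_zero:
  assumes "\<alpha> \<in> {1..2}"
  shows "(\<lambda>k. (tent_map ^^ (k ^ 3 + (2 * k\<^sup>2 + 1) + l)) (seed \<alpha>)) \<longlonglongrightarrow> 0"
proof -
  have "eventually (\<lambda>k. seed_pos \<alpha> k < 2 * k\<^sup>2 + 1 + l \<and> 2 * k\<^sup>2 + 1 + l \<le> 2 * k\<^sup>2 + 2 * k) sequentially"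
    using eventually_ge_at_top[of "l+1"]
  proof eventually_elim
    case (elim k)
    thus ?case using seed_pos_bounds(2)[OF assms, of k] by linarith
  qed
  from seed_tendsto_0[OF assms this] show ?thesis by (simp add: add_ac)
qed

lemma seed_pos_gap:
  assumes "\<alpha> < \<beta>" "0 \<le> \<alpha>"
  shows "eventually (\<lambda>k. seed_pos \<alpha> k + i < seed_pos \<beta> k) sequentially"
  \<comment> \<open>Of the 2 in \<open>real i + 2\<close>, one unit pays for the floor and the other
    makes the inequality strict; the final 1 ensures \<open>k \<ge> 1\<close>, so that
    \<open>k \<le> k^2\<close>.\<close>
  using eventually_ge_at_top[of "nat \<lceil>(real i + 2) / (\<beta> - \<alpha>)\<rceil> + 1"]
proof eventually_elim
  case (elim k)
  hence "(real i + 2) / (\<beta> - \<alpha>) \<le> real k" "1 \<le> k" by linarith+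
  hence "real i + 2 \<le> real k * (\<beta> - \<alpha>)" using assms by (simp add: pos_divide_le_eq)
  also have "\<dots> \<le> real k ^ 2 * (\<beta> - \<alpha>)"
    using \<open>1 \<le> k\<close> assms by (intro mult_right_mono) (auto simp: power2_eq_square)
  finally have "real k ^ 2 * \<alpha> + i + 2 \<le> real k ^ 2 * \<beta>" by (simp add: algebra_simps)
  hence "\<lfloor>real k ^ 2 * \<alpha>\<rfloor> + int i + 1 \<le> \<lfloor>real k ^ 2 * \<beta>\<rfloor>" by linarith
  moreover have "0 \<le> \<lfloor>real k ^ 2 * \<alpha>\<rfloor>" using assms by simp
  ultimately show ?case unfolding seed_pos_def by linarith
qed

text \<open>At the chosen time the \<open>i\<close>-th shift of \<open>seed \<beta>\<close> stands
  on its digit 1. The \<open>j\<close>-th shift of \<open>seed \<alpha>\<close> is already past its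
  own, by the drift of the offsets if \<open>\<alpha> < \<beta>\<close>, and by \<open>i < j\<close>
  if the parameters agree.\<close>

lemma seed_separated:
  assumes \<alpha>: "\<alpha> \<in> {1..2}" and \<beta>: "\<beta> \<in> {1..2}" and less: "\<alpha> < \<beta> \<or> \<alpha> = \<beta> \<and> i < j"
  obtains \<sigma> where "filterlim \<sigma> at_top sequentially"
    "(\<lambda>k. (tent_map ^^ (\<sigma> k + i)) (seed \<beta>)) \<longlonglongrightarrow> 1"
    "(\<lambda>k. (tent_map ^^ (\<sigma> k + j)) (seed \<alpha>)) \<longlonglongrightarrow> 0"
proof
  \<comment> \<open>The truncated subtraction is a true one once \<open>k \<ge> i\<close>, because
    the offset is at least \<open>k^2\<close>.\<close>
  define \<sigma> where "\<sigma> k = k ^ 3 + (seed_pos \<beta> k - i)" for k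
  show "filterlim \<sigma> at_top sequentially" unfolding \<sigma>_def by (rule filterlim_cube_add)
  have i: "eventually (\<lambda>k. \<sigma> k + i = k ^ 3 + seed_pos \<beta> k) sequentially"
    using eventually_ge_at_top[of i]
  proof eventually_elim
    case (elim k)
    have "k \<le> k\<^sup>2" by (rule self_le_power2_nat)
    thus ?case using elim seed_pos_bounds(1)[OF \<beta>, of k] by (simp add: \<sigma>_def)
  qed
  show "(\<lambda>k. (tent_map ^^ (\<sigma> k + i)) (seed \<beta>)) \<longlonglongrightarrow> 1"
    by (rule Lim_transform_eventually[OF seed_tendsto_1[OF \<beta>]]) (use i in eventually_elim, simp)
  define s where "s k = seed_pos \<beta> k - i + j" for k
  have "eventually (\<lambda>k. seed_pos \<alpha> k + i < seed_pos \<beta> k + j) sequentially"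
  proof (cases "\<alpha> < \<beta>")
    case True
    hence "eventually (\<lambda>k. seed_pos \<alpha> k + i < seed_pos \<beta> k) sequentially"
      using \<alpha> by (intro seed_pos_gap) auto
    thus ?thesis by eventually_elim simp
  qed (use less in simp)
  hence "eventually (\<lambda>k. seed_pos \<alpha> k < s k \<and> s k \<le> 2 * k\<^sup>2 + 2 * k) sequentially"
    using eventually_ge_at_top[of j] i
  proof eventually_elim
    case (elim k)
    thus ?case using seed_pos_bounds(2)[OF \<beta>, of k] by (auto simp: s_def \<sigma>_def)
  qed
  from seed_tendsto_0[OF \<alpha> this]
  show "(\<lambda>k. (tent_map ^^ (\<sigma> k + j)) (seed \<alpha>)) \<longlonglongrightarrow> 0"
    by (simp add: s_def \<sigma>_def add.assoc)
qed

lemma seed_in: "seed \<alpha> \<in> {0..1}"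
  unfolding seed_def by (rule tri_wave_in)

text \<open>Just after the digit 1 of the \<open>n\<close>-th block, whatever the parameter of the seed.\<close>

definition zero_time :: "nat \<Rightarrow> nat" where "zero_time n = n ^ 3 + (2 * n\<^sup>2 + 1)"

lemma filterlim_zero_time: "filterlim (\<lambda>n. zero_time n + s n) at_top sequentially"
  unfolding zero_time_def using filterlim_cube_add[of "\<lambda>n. 2 * n\<^sup>2 + 1 + s n"] by (simp add: add.assoc)

subsection \<open>The semiconjugacy to the tent map\<close>

text \<open>Only the lower bound \<open>v\<close> has to converge: when a point is compared with a
  periodic one, the iterates of the latter along \<open>\<sigma>\<close> may oscillate.\<close>

lemma limsup_ge_subseq:
  fixes u v :: "nat \<Rightarrow> real"
  assumes \<sigma>: "filterlim \<sigma> at_top sequentially" and v: "v \<longlonglongrightarrow> c"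
    and le: "\<And>k. v k \<le> u (\<sigma> k)"
  shows "ereal c \<le> limsup (\<lambda>n. ereal (u n))"
proof (rule ccontr)
  assume "\<not> ereal c \<le> limsup (\<lambda>n. ereal (u n))"
  then obtain y where y: "limsup (\<lambda>n. ereal (u n)) < ereal y" "ereal y < ereal c"
    using ereal_dense2[of "limsup (\<lambda>n. ereal (u n))" "ereal c"] by (auto simp: not_le)
  have "eventually (\<lambda>n. u n < y) sequentially" using Limsup_lessD[OF y(1)] by simp
  hence "eventually (\<lambda>k. u (\<sigma> k) < y) sequentially"
    by (rule eventually_compose_filterlim[OF _ \<sigma>])
  hence "eventually (\<lambda>k. v k \<le> y) sequentially"
    by eventually_elim (use le in \<open>meson le_less_trans less_imp_le\<close>)
  with v have "c \<le> y" by (rule tendsto_upperbound) simp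
  with y(2) show False by simp
qed

lemma liminf_le_subseq:
  fixes u :: "nat \<Rightarrow> real"
  assumes \<sigma>: "filterlim \<sigma> at_top sequentially" and u: "(\<lambda>k. u (\<sigma> k)) \<longlonglongrightarrow> c"
  shows "liminf (\<lambda>n. ereal (u n)) \<le> ereal c"
proof (rule ccontr)
  assume "\<not> liminf (\<lambda>n. ereal (u n)) \<le> ereal c"
  then obtain y where y: "ereal y < liminf (\<lambda>n. ereal (u n))" "ereal c < ereal y"
    using ereal_dense2[of "ereal c" "liminf (\<lambda>n. ereal (u n))"] by (auto simp: not_le)
  have "eventually (\<lambda>n. y < u n) sequentially" using less_LiminfD[OF y(1)] by simp
  hence "eventually (\<lambda>k. y < u (\<sigma> k)) sequentially"
    by (rule eventually_compose_filterlim[OF _ \<sigma>])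
  hence "eventually (\<lambda>k. y \<le> u (\<sigma> k)) sequentially" by eventually_elim simp
  with u have "y \<le> c" by (rule tendsto_lowerbound) simp
  with y(2) show False by simp
qed

lemma dense_in_setD:
  assumes "dense_in_set D X" "open U" "U \<inter> X \<noteq> {}"
  shows "U \<inter> D \<noteq> {}"
proof -
  have "U \<inter> closure D \<noteq> {}" using assms by (auto simp: dense_in_set_def)
  thus ?thesis using open_Int_closure_eq_empty[OF assms(2)] by blast
qed

lemma funpow_fixed_mult: "(f ^^ m) p = p \<Longrightarrow> (f ^^ (m * k)) p = p"
  by (induction k) (simp_all add: funpow_add)

section \<open>Full unimodal maps and the monotone solution of the functional equation\<close>

locale full_unimodal =
  fixes f :: "real \<Rightarrow> real" and a :: real
  assumes a_pos: "0 < a" and a_less: "a < 1"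
    and cont: "continuous_on {0..1} f" and onto: "f ` {0..1} = {0..1}"
    and f_0: "f 0 = 0" and f_1: "f 1 = 0" and f_a: "f a = 1"
    and incr: "strict_mono_on {0..a} f"
    and decr: "strict_antimono_on {a..1} f"
begin

lemma f_in: "x \<in> {0..1} \<Longrightarrow> f x \<in> {0..1}"
  using onto by blast

lemma iter_in: "x \<in> {0..1} \<Longrightarrow> (f ^^ n) x \<in> {0..1}"
  by (induction n) (simp_all add: f_in del: atLeastAtMost_iff)

lemma iter_cont: "continuous_on {0..1} (f ^^ n)"
proof (induction n)
  case (Suc n)
  have "continuous_on ((f ^^ n) ` {0..1}) f"
    using cont by (rule continuous_on_subset) (use iter_in in blast)
  with Suc show ?case by (auto dest: continuous_on_compose simp: o_def)
qed (simp add: id_def)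

lemma f_less_left: "0 \<le> x \<Longrightarrow> x < y \<Longrightarrow> y \<le> a \<Longrightarrow> f x < f y"
  using incr by (auto simp: strict_mono_on_def)

lemma f_less_right: "a \<le> x \<Longrightarrow> x < y \<Longrightarrow> y \<le> 1 \<Longrightarrow> f y < f x"
  using decr by (auto simp: monotone_on_def)

lemma f_le_left: "0 \<le> x \<Longrightarrow> x \<le> y \<Longrightarrow> y \<le> a \<Longrightarrow> f x \<le> f y"
  using f_less_left[of x y] by (cases "x = y") auto

lemma f_le_right: "a \<le> x \<Longrightarrow> x \<le> y \<Longrightarrow> y \<le> 1 \<Longrightarrow> f y \<le> f x"
  using f_less_right[of x y] by (cases "x = y") auto

text \<open>
  Picard iterates for the functional equation of the semiconjugacy to the tent map; the two
  branches agree at \<open>a\<close> because each iterate sends 1 to 1.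
\<close>

primrec semi :: "nat \<Rightarrow> real \<Rightarrow> real" where
  "semi 0 = (\<lambda>x. x)"
| "semi (Suc n) = (\<lambda>x. if x \<le> a then semi n (f x) / 2 else 1 - semi n (f x) / 2)"

lemma semi_Suc: "semi (Suc n) x = (if x \<le> a then semi n (f x) / 2 else 1 - semi n (f x) / 2)"
  by simp

lemma semi_in: "x \<in> {0..1} \<Longrightarrow> semi n x \<in> {0..1}"
proof (induction n arbitrary: x)
  case (Suc n)
  from Suc.IH[OF f_in[OF Suc.prems]] show ?case by auto
qed simp

lemma semi_0: "semi n 0 = 0"
  using a_pos by (induction n) (auto simp: f_0)

lemma semi_1: "semi n 1 = 1"
  using a_less by (cases n) (auto simp: f_1 semi_0)

lemma semi_cont: "continuous_on {0..1} (semi n)"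
proof (induction n)
  case (Suc n)
  have c: "continuous_on {0..1} (\<lambda>x. semi n (f x))"
    using Suc cont by (rule continuous_on_compose2) (simp add: onto)
  have "continuous_on ({0..a} \<union> {a..1})
      (\<lambda>x. if x \<le> a then semi n (f x) / 2 else 1 - semi n (f x) / 2)"
  proof (rule continuous_on_If)
    show "continuous_on {0..a} (\<lambda>x. semi n (f x) / 2)"
      using a_less by (intro continuous_intros continuous_on_subset[OF c]) auto
    show "continuous_on {a..1} (\<lambda>x. 1 - semi n (f x) / 2)"
      using a_pos by (intro continuous_intros continuous_on_subset[OF c]) auto
  qed (auto simp: f_a semi_1)
  moreover have "{0..a} \<union> {a..1} = {0..1}" using a_pos a_less by auto
  ultimately show ?case by simp
qed simp

text \<open>Values left of \<open>a\<close> are at most \<open>1/2\<close>, values right of it at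
  least \<open>1/2\<close>. On the right branch the order is reversed twice, by \<open>f\<close> and
  by the minus sign.\<close>

lemma semi_mono: "x \<in> {0..1} \<Longrightarrow> y \<in> {0..1} \<Longrightarrow> x \<le> y \<Longrightarrow> semi n x \<le> semi n y"
proof (induction n arbitrary: x y)
  case (Suc n)
  have fx: "f x \<in> {0..1}" "f y \<in> {0..1}" using Suc.prems f_in by auto
  consider "y \<le> a" | "x \<le> a" "a < y" | "a < x" using Suc.prems by linarith
  thus ?case
  proof cases
    case 1
    have "f x \<le> f y" by (rule f_le_left) (use 1 Suc.prems in auto)
    with Suc.IH[OF fx] 1 Suc.prems show ?thesis by simp
  next
    case 2
    with semi_in[OF fx(1), of n] semi_in[OF fx(2), of n] show ?thesis by simp
  next
    case 3
    have "f y \<le> f x" by (rule f_le_right) (use 3 Suc.prems in auto)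
    with Suc.IH[OF fx(2,1)] 3 Suc.prems show ?thesis by simp
  qed
qed simp

text \<open>Both iterates take the same branch at \<open>x\<close>, so their difference is half of
  the one at \<open>f x\<close>; the first difference is at most 1 because the values lie in
  \<open>[0, 1]\<close>.\<close>

lemma semi_step: "x \<in> {0..1} \<Longrightarrow> \<bar>semi (Suc n) x - semi n x\<bar> \<le> (1/2) ^ n"
proof (induction n arbitrary: x)
  case 0
  show ?case using semi_in[OF 0, of "Suc 0"] semi_in[OF 0, of 0] by (auto simp del: semi.simps)
next
  case (Suc n)
  have half: "\<bar>A / 2 - B / 2\<bar> = \<bar>A - B\<bar> / 2" "\<bar>(1 - A / 2) - (1 - B / 2)\<bar> = \<bar>A - B\<bar> / 2"
    for A B :: real by (simp_all add: abs_if field_simps)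
  have "\<bar>semi (Suc (Suc n)) x - semi (Suc n) x\<bar> = \<bar>semi (Suc n) (f x) - semi n (f x)\<bar> / 2"
    unfolding semi_Suc[of "Suc n" x] semi_Suc[of n x] by (cases "x \<le> a") (simp_all only: half if_True if_False not_False_eq_True)
  thus ?case using Suc.IH[OF f_in[OF Suc.prems]] by simp
qed

text \<open>The limit of \<open>semi n x\<close>, written as a telescoping series starting from
  \<open>semi 0 x = x\<close>, so that the Weierstrass M-test applies.\<close>

definition conj_map :: "real \<Rightarrow> real" where
  "conj_map x = x + (\<Sum>n. semi (Suc n) x - semi n x)"

abbreviation "h \<equiv> conj_map"

lemma uniform_limit_h: "uniform_limit {0..1} semi h sequentially"
proof -
  have "uniform_limit {0..1} (\<lambda>n x. \<Sum>i<n. semi (Suc i) x - semi i x)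
      (\<lambda>x. \<Sum>n. semi (Suc n) x - semi n x) sequentially"
  proof (rule Weierstrass_m_test)
    show "summable (\<lambda>n. (1/2::real) ^ n)" by (rule summable_geometric) simp
  qed (use semi_step in \<open>simp del: semi.simps\<close>)
  hence "uniform_limit {0..1} (\<lambda>n x. x + (\<Sum>i<n. semi (Suc i) x - semi i x))
      (\<lambda>x. x + (\<Sum>n. semi (Suc n) x - semi n x)) sequentially"
    by (intro uniform_limit_intros)
  thus ?thesis
    by (simp add: conj_map_def[abs_def] sum_lessThan_telescope[of "\<lambda>n. semi n _"] del: semi.simps(2))
qed

lemma semi_tendsto: "x \<in> {0..1} \<Longrightarrow> (\<lambda>n. semi n x) \<longlonglongrightarrow> h x"
  using uniform_limit_h by (rule tendsto_uniform_limitI)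

lemma h_cont: "continuous_on {0..1} h"
  by (rule uniform_limit_theorem[OF _ uniform_limit_h]) (use semi_cont in auto)

lemma h_mono: "x \<in> {0..1} \<Longrightarrow> y \<in> {0..1} \<Longrightarrow> x \<le> y \<Longrightarrow> h x \<le> h y"
  by (rule LIMSEQ_le[OF semi_tendsto semi_tendsto]) (use semi_mono in auto)

lemma h_0: "h 0 = 0" and h_1: "h 1 = 1"
  using semi_tendsto[of 0] semi_tendsto[of 1] by (simp_all add: semi_0 semi_1 LIMSEQ_const_iff)

lemma h_in: "x \<in> {0..1} \<Longrightarrow> h x \<in> {0..1}"
  using h_mono[of 0 x] h_mono[of x 1] by (auto simp: h_0 h_1)

lemma h_left: assumes "x \<in> {0..a}" shows "h x = h (f x) / 2"
proof (rule LIMSEQ_unique)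
  have x: "x \<in> {0..1}" using assms a_less by auto
  show "(\<lambda>n. semi (Suc n) x) \<longlonglongrightarrow> h x" using semi_tendsto[OF x] by (rule LIMSEQ_Suc)
  have "(\<lambda>n. semi n (f x) / 2) \<longlonglongrightarrow> h (f x) / 2"
    by (intro tendsto_intros semi_tendsto f_in x) simp
  thus "(\<lambda>n. semi (Suc n) x) \<longlonglongrightarrow> h (f x) / 2" using assms by simp
qed

lemma h_right: assumes "x \<in> {a..1}" shows "h x = 1 - h (f x) / 2"
\<comment> \<open>At \<open>a\<close> itself \<open>semi\<close> takes the left branch; both
  formulas give \<open>1/2\<close> there, since \<open>f a = 1\<close> and
  \<open>h 1 = 1\<close>.\<close>
proof (cases "x = a")
  case True
  with h_left[of a] a_pos show ?thesis by (simp add: f_a h_1)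
next
  case False
  have x: "x \<in> {0..1}" using assms a_pos by auto
  show ?thesis
  proof (rule LIMSEQ_unique)
    show "(\<lambda>n. semi (Suc n) x) \<longlonglongrightarrow> h x" using semi_tendsto[OF x] by (rule LIMSEQ_Suc)
    have "(\<lambda>n. 1 - semi n (f x) / 2) \<longlonglongrightarrow> 1 - h (f x) / 2"
      by (intro tendsto_intros semi_tendsto f_in x) simp
    thus "(\<lambda>n. semi (Suc n) x) \<longlonglongrightarrow> 1 - h (f x) / 2" using assms False by simp
  qed
qed

lemma h_le_half: "x \<in> {0..a} \<Longrightarrow> h x \<le> 1/2"
  using h_left[of x] h_in[of "f x"] f_in[of x] a_less by auto

lemma h_ge_half: "x \<in> {a..1} \<Longrightarrow> 1/2 \<le> h x"
  using h_right[of x] h_in[of "f x"] f_in[of x] a_pos by auto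

lemma h_f: "x \<in> {0..1} \<Longrightarrow> h (f x) = tent_map (h x)"
  using h_left[of x] h_right[of x] h_le_half[of x] h_ge_half[of x]
  by (cases "x \<le> a") (auto simp: tent_map_def)

lemma h_iter: "x \<in> {0..1} \<Longrightarrow> h ((f ^^ n) x) = (tent_map ^^ n) (h x)"
  by (induction n) (simp_all add: h_f iter_in del: atLeastAtMost_iff)

lemma h_onto_interval:
  assumes "0 \<le> u" "u \<le> v" "v \<le> 1" "y \<in> {h u..h v}"
  obtains x where "x \<in> {u..v}" "h x = y"
  using IVT'[of h u y v] assms continuous_on_subset[OF h_cont, of "{u..v}"] by auto

lemma h_onto: "h ` {0..1} = {0..1}"
proof
  show "{0..1} \<subseteq> h ` {0..1}"
  proof
    fix y :: real assume "y \<in> {0..1}"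
    thus "y \<in> h ` {0..1}" by (elim h_onto_interval[of 0 1 y, unfolded h_0 h_1, rotated 3]) auto
  qed
qed (use h_in in blast)

subsection \<open>Injectivity of the semiconjugacy\<close>

lemma not_inj_onE:
  assumes "\<not> inj_on h {0..1}"
  obtains u v where "0 \<le> u" "u < v" "v \<le> 1" "h u = h v"
proof -
  obtain x y where xy: "x \<in> {0..1}" "y \<in> {0..1}" "h x = h y" "x \<noteq> y"
    using assms by (auto simp: inj_on_def)
  show thesis
    by (cases "x < y") (use that[of x y] that[of y x] xy in auto)
qed

text \<open>Fibers of a monotone map are convex, so two points with equal values bound a whole
  interval of constancy.\<close>

lemma h_const_between:
  assumes "u \<in> {0..1}" "v \<in> {0..1}" "h u = h v" "x \<in> {u..v}"
  shows "h x = h u"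
  using h_mono[of u x] h_mono[of x v] assms by auto

lemma inj_if_dense_orbit:
  assumes "has_dense_orbit f {0..1}"
  shows "inj_on h {0..1}"
proof (rule ccontr)
  assume "\<not> inj_on h {0..1}"
  then obtain u v where uv: "0 \<le> u" "u < v" "v \<le> 1" "h u = h v" by (rule not_inj_onE)
  obtain c where c: "c \<in> {0..1}" and dense: "dense_in_set (orbit_of f c) {0..1}"
    using assms by (auto simp: has_dense_orbit_def)
  have visit: "\<exists>k. (f ^^ k) c \<in> U" if "open U" "U \<inter> {0..1} \<noteq> {}" for U
    using dense_in_setD[OF dense that] by (auto simp: orbit_of_def)
  have "(u + v) / 2 \<in> {u<..<v} \<inter> {0..1}" using uv by auto
  then obtain k where k: "(f ^^ k) c \<in> {u<..<v}"
    using visit[of "{u<..<v}"] by (metis empty_iff open_greaterThanLessThan)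
  \<comment> \<open>Deleting the first orbit points leaves a nonempty open set, so the orbit must
    return at a time later than \<open>k\<close>.\<close>
  define U where "U = {u<..<v} - (\<lambda>i. (f ^^ i) c) ` {..k}"
  have "open U" unfolding U_def by (intro open_Diff finite_imp_closed) auto
  moreover have "U \<noteq> {}"
    unfolding U_def using uv infinite_Ioo[of u v] finite_subset[of "{u<..<v}"] by blast
  moreover have "U \<subseteq> {0..1}" using uv by (auto simp: U_def)
  ultimately obtain l where l: "(f ^^ l) c \<in> U" using visit[of U] by blast
  hence "k < l" by (force simp: U_def not_le[symmetric])
  define m where "m = l - k"
  have m: "1 \<le> m" "l = m + k" using \<open>k < l\<close> by (auto simp: m_def)
  have "h ((f ^^ l) c) = h ((f ^^ k) c)"
  proof -
    have "u \<in> {0..1}" "v \<in> {0..1}" "(f ^^ k) c \<in> {u..v}" "(f ^^ l) c \<in> {u..v}"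
      using uv(1-3) k l by (auto simp: U_def)
    note h_const_between[OF this(1,2) uv(4) this(3)] h_const_between[OF this(1,2) uv(4) this(4)]
    thus ?thesis by simp
  qed
  hence per: "(tent_map ^^ (m + k)) (h c) = (tent_map ^^ k) (h c)"
    using h_iter[OF c] m by simp
  have fin: "(tent_map ^^ n) (h c) \<in> (\<lambda>i. (tent_map ^^ i) (h c)) ` {..<m + k}" for n
  proof (induction n rule: less_induct)
    case (less n)
    show ?case
    proof (cases "n < m + k")
      case False
      define d where "d = n - (m + k)"
      have n: "n = d + (m + k)" using False by (simp add: d_def)
      have "(tent_map ^^ n) (h c) = (tent_map ^^ (d + k)) (h c)"
        unfolding n funpow_add[of d] comp_apply per by simp
      thus ?thesis using less[of "d + k"] m(1) n by simp
    qed simp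
  qed
  \<comment> \<open>The preimage of this finite set is closed and contains a dense orbit, hence is
    everything; as \<open>h\<close> is onto, \<open>[0, 1]\<close> would be finite.\<close>
  define B where "B = (\<lambda>i. (tent_map ^^ i) (h c)) ` {..<m + k}"
  have "closed ({0..1} \<inter> h -` B)"
    by (rule continuous_closed_preimage[OF h_cont closed_atLeastAtMost]) (simp add: B_def finite_imp_closed)
  moreover have "orbit_of f c \<subseteq> {0..1} \<inter> h -` B"
    using fin iter_in[OF c] h_iter[OF c] by (auto simp: orbit_of_def B_def simp del: atLeastAtMost_iff)
  ultimately have "closure (orbit_of f c) \<subseteq> {0..1} \<inter> h -` B" by (rule closure_minimal[rotated])
  moreover have "{0..1} \<subseteq> closure (orbit_of f c)" using dense by (simp add: dense_in_set_def)
  ultimately have "{0..1} \<subseteq> h -` B" by blast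
  hence "h ` {0..1} \<subseteq> B" by blast
  hence "{0..1} \<subseteq> B" by (simp only: h_onto)
  hence "finite {0..1::real}" by (rule finite_subset) (simp add: B_def)
  thus False using infinite_Icc[of 0 "1::real"] by simp
qed

lemma f_onto_left:
  assumes "y \<in> {0..1}"
  obtains x where "x \<in> {0..a}" "f x = y"
  using IVT'[of f 0 y a] assms a_pos a_less continuous_on_subset[OF cont, of "{0..a}"]
  by (auto simp: f_0 f_a)

lemma f_onto_right:
  assumes "y \<in> {0..1}"
  obtains x where "x \<in> {a..1}" "f x = y"
  using IVT2'[of f 1 y a] assms a_pos a_less continuous_on_subset[OF cont, of "{a..1}"]
  by (auto simp: f_1 f_a)

lemma inj_if_dense_periodic:
  assumes "dense_in_set (periodic_points f {0..1}) {0..1}"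
  shows "inj_on h {0..1}"
proof (rule ccontr)
  assume "\<not> inj_on h {0..1}"
  then obtain u v where uv: "0 \<le> u" "u < v" "v \<le> 1" "h u = h v" by (rule not_inj_onE)
  have visit: "\<exists>x m. x \<in> {p<..<q} \<and> 1 \<le> m \<and> (f ^^ m) x = x" if "0 \<le> p" "p < q" "q \<le> 1" for p q
  proof -
    have "(p + q) / 2 \<in> {p<..<q} \<inter> {0..1}" using that by auto
    hence "{p<..<q} \<inter> periodic_points f {0..1} \<noteq> {}"
      by (intro dense_in_setD[OF assms]) (simp, blast)
    thus ?thesis by (auto simp: periodic_points_def)
  qed
  obtain w m where w: "w \<in> {u<..<v}" and m: "1 \<le> m" "(f ^^ m) w = w"
    using visit[of u v] uv by auto
  have w01: "w \<in> {0..1}" using w uv by auto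
  \<comment> \<open>The predecessor of \<open>w\<close> on its own periodic orbit.\<close>
  define w' where "w' = (f ^^ (m - 1)) w"
  have w': "w' \<in> {0..1}" unfolding w'_def by (rule iter_in[OF w01])
  have "f w' = (f ^^ Suc (m - 1)) w" by (simp add: w'_def)
  hence fw': "f w' = w" using m by simp
  have "(f ^^ m) w' = (f ^^ (m - 1)) ((f ^^ m) w)"
    unfolding w'_def by (metis add.commute comp_apply funpow_add)
  hence mw': "(f ^^ m) w' = w'" using m by (simp add: w'_def)
  have "w' \<noteq> a" using fw' f_a w uv by auto
  \<comment> \<open>An interval on the side of \<open>a\<close> opposite to \<open>w'\<close>,
    mapped into \<open>{u<..<v}\<close>. The values of \<open>h\<close> on the two sides have only
    \<open>1/2\<close> in common.\<close>
  obtain p q where pq: "0 \<le> p" "p < q" "q \<le> 1"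
    "\<And>x. x \<in> {p<..<q} \<Longrightarrow> f x \<in> {u<..<v}"
    "\<And>x. x \<in> {p<..<q} \<Longrightarrow> h x = h w' \<Longrightarrow> h w' = 1/2"
  proof (cases "w' < a")
    case True
    obtain p where p: "p \<in> {a..1}" "f p = v" using f_onto_right[of v] uv by auto
    obtain q where q: "q \<in> {a..1}" "f q = u" using f_onto_right[of u] uv by auto
    have "p < q"
    proof (rule ccontr)
      assume "\<not> p < q"
      hence "f p \<le> f q" using p q by (intro f_le_right) auto
      thus False using p q uv by simp
    qed
    show thesis
    proof (rule that[of p q])
      fix x assume x: "x \<in> {p<..<q}"
      show "f x \<in> {u<..<v}" using f_less_right[of p x] f_less_right[of x q] p q x by auto
      show "h x = h w' \<Longrightarrow> h w' = 1/2" using h_ge_half[of x] h_le_half[of w'] p q x w' True by auto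
    qed (use p q \<open>p < q\<close> a_pos in auto)
  next
    case False
    obtain p where p: "p \<in> {0..a}" "f p = u" using f_onto_left[of u] uv by auto
    obtain q where q: "q \<in> {0..a}" "f q = v" using f_onto_left[of v] uv by auto
    have "p < q"
    proof (rule ccontr)
      assume "\<not> p < q"
      hence "f q \<le> f p" using p q by (intro f_le_left) auto
      thus False using p q uv by simp
    qed
    show thesis
    proof (rule that[of p q])
      fix x assume x: "x \<in> {p<..<q}"
      show "f x \<in> {u<..<v}" using f_less_left[of p x] f_less_left[of x q] p q x by auto
      show "h x = h w' \<Longrightarrow> h w' = 1/2" using h_le_half[of x] h_ge_half[of w'] p q x w' False by auto
    qed (use p q \<open>p < q\<close> a_less in auto)
  qed
  obtain x n where x: "x \<in> {p<..<q}" and n: "1 \<le> n" "(f ^^ n) x = x"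
    using visit[of p q] pq(1-3) by blast
  have x01: "x \<in> {0..1}" using x pq(1-3) by auto
  have "m * n \<noteq> 0" using m(1) n(1) by simp
  then obtain P where P: "m * n = Suc P" using not0_implies_Suc by blast
  \<comment> \<open>Going once around the orbit but for one step turns the value at
    \<open>f y\<close> into the value at \<open>y\<close>. As \<open>x\<close> and \<open>w'\<close>
    share the period \<open>m * n\<close> and \<open>h (f x) = h (f w')\<close>, it follows that
    \<open>h x = h w'\<close>.\<close>
  have iter_P: "h y = (tent_map ^^ P) (h (f y))" if "(f ^^ (m * n)) y = y" "y \<in> {0..1}" for y
    using that h_iter[of "f y" P] f_in[of y] by (simp add: P funpow_swap1)
  have "h x = (tent_map ^^ P) (h (f x))"
    using funpow_fixed_mult[OF n(2), of m] x01 by (intro iter_P) (simp_all add: mult.commute)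
  also have "h (f x) = h (f w')"
    using h_const_between[of u v "f x"] h_const_between[of u v w] pq(4)[OF x] w uv fw' by auto
  also have "(tent_map ^^ P) (h (f w')) = h w'"
    using funpow_fixed_mult[OF mw', of n] w' iter_P[of w'] by simp
  finally have "h w' = 1/2" by (rule pq(5)[OF x])
  moreover have "(tent_map ^^ m) (h w') = h w'" using h_iter[OF w', of m] mw' by simp
  ultimately show False using tent_periodic_neq_half[of m "h w'" 0] m by simp
qed

section \<open>Sensitive dependence forces injectivity\<close>

text \<open>Only the iterates below \<open>N\<close> remain, and finitely many continuous maps are
  controlled together near the midpoint.\<close>

lemma insensitive_point:
  assumes "0 \<le> u" "u < v" "v \<le> 1" "0 < \<delta>"
    and small: "\<And>n x y. N \<le> n \<Longrightarrow> x \<in> {u..v} \<Longrightarrow> y \<in> {u..v} \<Longrightarrow> \<bar>(f ^^ n) x - (f ^^ n) y\<bar> < \<delta>"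
  obtains x V where "x \<in> {0..1}" "openin (top_of_set {0..1}) V" "x \<in> V"
    "\<And>n y. y \<in> V \<Longrightarrow> \<bar>(f ^^ n) x - (f ^^ n) y\<bar> < \<delta>"
proof -
  define x where "x = (u + v) / 2"
  have x: "x \<in> {0..1}" "u < x" "x < v" using assms by (auto simp: x_def)
  have "\<exists>d>0. \<forall>n<N. \<forall>y\<in>{0..1}. \<bar>y - x\<bar> < d \<longrightarrow> \<bar>(f ^^ n) x - (f ^^ n) y\<bar> < \<delta>"
  proof (induction N)
    case 0
    show ?case by (intro exI[of _ 1]) simp
  next
    case (Suc N)
    then obtain d where d: "d > 0" "\<And>n y. n < N \<Longrightarrow> y \<in> {0..1} \<Longrightarrow> \<bar>y - x\<bar> < d \<Longrightarrow> \<bar>(f ^^ n) x - (f ^^ n) y\<bar> < \<delta>"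
      by blast
    obtain e where e: "e > 0" "\<And>y. y \<in> {0..1} \<Longrightarrow> \<bar>y - x\<bar> < e \<Longrightarrow> \<bar>(f ^^ N) x - (f ^^ N) y\<bar> < \<delta>"
      using iter_cont[of N] x(1) \<open>0 < \<delta>\<close>
      by (fastforce simp: continuous_on_iff dist_real_def abs_minus_commute simp del: atLeastAtMost_iff)
    show ?case using d e by (intro exI[of _ "min d e"]) (auto simp: less_Suc_eq)
  qed
  then obtain d where d: "d > 0" "\<And>n y. n < N \<Longrightarrow> y \<in> {0..1} \<Longrightarrow> \<bar>y - x\<bar> < d \<Longrightarrow> \<bar>(f ^^ n) x - (f ^^ n) y\<bar> < \<delta>"
    by blast
  show thesis
  proof (rule that[of x "{0..1} \<inter> ({u<..<v} \<inter> {x - d<..<x + d})"])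
    fix n y assume y: "y \<in> {0..1} \<inter> ({u<..<v} \<inter> {x - d<..<x + d})"
    show "\<bar>(f ^^ n) x - (f ^^ n) y\<bar> < \<delta>"
    proof (cases "n < N")
      case True
      thus ?thesis using d(2)[of n y] y by (auto simp: abs_less_iff)
    next
      case False
      thus ?thesis using small[of n x y] y x by auto
    qed
  qed (use x d in \<open>auto intro: openin_open_Int\<close>)
qed

lemma nondegenerate_fiber_step:
  assumes "0 \<le> u" "u < v" "v \<le> 1" "h u = h v"
  shows "\<exists>u' v'. 0 \<le> u' \<and> u' < v' \<and> v' \<le> 1 \<and> h u' = tent_map (h u) \<and> h v' = tent_map (h u)"
proof -
  \<comment> \<open>The interval may straddle \<open>a\<close> and its ends may have the same image;
    but one of its halves lies on a single branch, where \<open>f\<close> is injective.\<close>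
  define w where "w = (u + v) / 2"
  have w: "u < w" "w < v" using assms by (auto simp: w_def)
  have "h w = h u" using h_const_between[of u v w] assms w by auto
  hence *: "h (f u) = tent_map (h u)" "h (f w) = tent_map (h u)" "h (f v) = tent_map (h u)"
    using h_f[of u] h_f[of w] h_f[of v] assms w by auto
  have in01: "f u \<in> {0..1}" "f w \<in> {0..1}" "f v \<in> {0..1}"
    using assms w by (auto intro!: f_in simp del: atLeastAtMost_iff simp: atLeastAtMost_iff[of u] atLeastAtMost_iff[of v] atLeastAtMost_iff[of w])
  show ?thesis
  proof (cases "w \<le> a")
    case True
    hence "f u < f w" using f_less_left[of u w] assms w by simp
    thus ?thesis using * in01 by (intro exI[of _ "f u"] exI[of _ "f w"]) auto
  next
    case False
    hence "f v < f w" using f_less_right[of w v] assms w by simp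
    thus ?thesis using * in01 by (intro exI[of _ "f v"] exI[of _ "f w"]) auto
  qed
qed

lemma nondegenerate_fiber_iter:
  assumes "0 \<le> u" "u < v" "v \<le> 1" "h u = h v"
  shows "\<exists>u' v'. 0 \<le> u' \<and> u' < v' \<and> v' \<le> 1 \<and> h u' = (tent_map ^^ i) (h u) \<and> h v' = (tent_map ^^ i) (h u)"
proof (induction i)
  case 0
  show ?case using assms by auto
next
  case (Suc i)
  then obtain u' v' where "0 \<le> u'" "u' < v'" "v' \<le> 1"
    "h u' = (tent_map ^^ i) (h u)" "h v' = (tent_map ^^ i) (h u)" by blast
  with nondegenerate_fiber_step[of u' v'] show ?case by simp
qed

text \<open>A fiber of length at least \<open>\<delta>\<close> contains a multiple of
  \<open>\<delta>\<close>, and only finitely many multiples are needed to cover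
  \<open>[0, 1]\<close>.\<close>

lemma finite_long_fibers:
  assumes "0 < \<delta>"
  shows "finite {t. \<exists>x\<in>{0..1}. \<exists>y\<in>{0..1}. \<delta> \<le> y - x \<and> h x = t \<and> h y = t}" (is "finite ?B")
proof (rule finite_subset)
  show "?B \<subseteq> (\<lambda>k. h (real k * \<delta>)) ` {..nat \<lceil>1 / \<delta>\<rceil>}"
  proof
    fix t assume "t \<in> ?B"
    then obtain x y where xy: "x \<in> {0..1}" "y \<in> {0..1}" "\<delta> \<le> y - x" "h x = t" "h y = t" by blast
    define k where "k = nat \<lceil>x / \<delta>\<rceil>"
    have "0 \<le> x / \<delta>" using xy assms by simp
    hence "x / \<delta> \<le> real k" "real k < x / \<delta> + 1" unfolding k_def by linarith+
    hence "x \<le> real k * \<delta>" "real k * \<delta> < x + \<delta>"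
      using assms by (simp_all add: field_simps)
    hence "h (real k * \<delta>) = t" using h_const_between[of x y "real k * \<delta>"] xy by auto
    moreover have "x / \<delta> \<le> 1 / \<delta>" using xy assms by (simp add: divide_right_mono)
    hence "k \<le> nat \<lceil>1 / \<delta>\<rceil>" unfolding k_def by (intro nat_mono ceiling_mono)
    ultimately show "t \<in> (\<lambda>k. h (real k * \<delta>)) ` {..nat \<lceil>1 / \<delta>\<rceil>}" by blast
  qed
qed simp

text \<open>Since the orbit of \<open>s\<close> avoids \<open>1/2\<close>, each successive fiber
  lies on one side of \<open>a\<close>, and every application of \<open>f\<close> preserves or
  reverses the order.\<close>

lemma iter_fiber_monotone:
  assumes "\<And>i. (tent_map ^^ i) s \<noteq> 1/2"
  defines "F \<equiv> {x \<in> {0..1}. h x = s}"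
  shows "(\<forall>x\<in>F. \<forall>y\<in>F. x \<le> y \<longrightarrow> (f ^^ n) x \<le> (f ^^ n) y) \<or>
    (\<forall>x\<in>F. \<forall>y\<in>F. x \<le> y \<longrightarrow> (f ^^ n) y \<le> (f ^^ n) x)"
proof (induction n)
  case (Suc n)
  define F' where "F' = {x \<in> {0..1}. h x = (tent_map ^^ n) s}"
  have F': "(f ^^ n) x \<in> F'" if "x \<in> F" for x
    using that iter_in[of x n] h_iter[of x n] by (auto simp: F_def F'_def)
  have "(\<forall>x\<in>F'. \<forall>y\<in>F'. x \<le> y \<longrightarrow> f x \<le> f y) \<or> (\<forall>x\<in>F'. \<forall>y\<in>F'. x \<le> y \<longrightarrow> f y \<le> f x)"
  proof (cases "(tent_map ^^ n) s < 1/2")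
    case True
    hence "x \<le> a" if "x \<in> F'" for x
      using that h_ge_half[of x] by (force simp: F'_def)
    thus ?thesis by (auto simp: F'_def intro!: f_le_left)
  next
    case False
    hence "a \<le> x" if "x \<in> F'" for x
      using that h_le_half[of x] assms(1)[of n] by (force simp: F'_def)
    thus ?thesis by (auto simp: F'_def intro!: f_le_right)
  qed
  with Suc F' show ?case by (auto; metis)
qed simp

lemma iter_uniform:
  assumes "0 < \<delta>"
  shows "\<exists>\<eta>>0. \<forall>r<M. \<forall>x\<in>{0..1}. \<forall>y\<in>{0..1}. \<bar>x - y\<bar> < \<eta> \<longrightarrow> \<bar>(f ^^ r) x - (f ^^ r) y\<bar> < \<delta>"
proof (induction M)
  case 0
  show ?case by (intro exI[of _ 1]) simp
next
  case (Suc M)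
  then obtain d where d: "d > 0" "\<And>r x y. r < M \<Longrightarrow> x \<in> {0..1} \<Longrightarrow> y \<in> {0..1} \<Longrightarrow> \<bar>x - y\<bar> < d
      \<Longrightarrow> \<bar>(f ^^ r) x - (f ^^ r) y\<bar> < \<delta>" by blast
  have "uniformly_continuous_on {0..1} (f ^^ M)"
    using iter_cont by (rule compact_uniformly_continuous) simp
  then obtain e where e: "e > 0" "\<And>x y. x \<in> {0..1} \<Longrightarrow> y \<in> {0..1} \<Longrightarrow> \<bar>x - y\<bar> < e
      \<Longrightarrow> \<bar>(f ^^ M) x - (f ^^ M) y\<bar> < \<delta>"
    using assms unfolding uniformly_continuous_on_def dist_real_def by (metis abs_minus_commute)
  show ?case using d e by (intro exI[of _ "min d e"]) (auto simp: less_Suc_eq)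
qed

text \<open>A return map of the fiber is increasing, so its orbits are monotone and bounded, hence
  convergent. This yields an interval whose images under the return map become short; uniform
  continuity handles the fewer than \<open>m * 2\<close> steps in between.\<close>

lemma periodic_fiber_insensitive:
  assumes s: "(tent_map ^^ m) s = s" "1 \<le> m"
    and uv: "0 \<le> u" "u < v" "v \<le> 1" "h u = s" "h v = s" and \<delta>: "0 < \<delta>"
  obtains N p q where "0 \<le> p" "p < q" "q \<le> 1"
    "\<And>n x y. N \<le> n \<Longrightarrow> x \<in> {p..q} \<Longrightarrow> y \<in> {p..q} \<Longrightarrow> \<bar>(f ^^ n) x - (f ^^ n) y\<bar> < \<delta>"
proof -
  define F where "F = {x \<in> {0..1}. h x = s}"
  \<comment> \<open>Twice the period, because \<open>f ^^ m\<close> may reverse the order on the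
    fiber.\<close>
  define G where "G = f ^^ (m * 2)"
  have G_F: "G x \<in> F" if "x \<in> F" for x
    using that iter_in[of x "m * 2"] h_iter[of x "m * 2"] funpow_fixed_mult[OF s(1), of 2]
    by (auto simp: F_def G_def)
  have "(\<forall>x\<in>F. \<forall>y\<in>F. x \<le> y \<longrightarrow> (f ^^ m) x \<le> (f ^^ m) y) \<or>
    (\<forall>x\<in>F. \<forall>y\<in>F. x \<le> y \<longrightarrow> (f ^^ m) y \<le> (f ^^ m) x)"
    unfolding F_def by (rule iter_fiber_monotone) (rule tent_periodic_neq_half[OF s])
  moreover have "(f ^^ m) x \<in> F" if "x \<in> F" for x
    using that iter_in[of x m] h_iter[of x m] s by (auto simp: F_def)
  moreover have "G x = (f ^^ m) ((f ^^ m) x)" for x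
    by (simp add: G_def mult_2_right funpow_add)
  ultimately have G_mono: "G x \<le> G y" if "x \<in> F" "y \<in> F" "x \<le> y" for x y
    using that by (auto; metis)
  have Gk_F: "(G ^^ k) x \<in> F" if "x \<in> F" for x k
    by (induction k) (use that G_F in auto)
  have Gk_mono: "(G ^^ k) x \<le> (G ^^ k) y" if "x \<in> F" "y \<in> F" "x \<le> y" for x y k
    by (induction k) (use that G_mono Gk_F in auto)
  obtain \<eta> where \<eta>: "\<eta> > 0" "\<And>r x y. r < m * 2 \<Longrightarrow> x \<in> {0..1} \<Longrightarrow> y \<in> {0..1} \<Longrightarrow> \<bar>x - y\<bar> < \<eta>
      \<Longrightarrow> \<bar>(f ^^ r) x - (f ^^ r) y\<bar> < \<delta>" using iter_uniform[OF \<delta>, of "m * 2"] by blast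
  have conv: "x \<in> F" if "p \<in> F" "q \<in> F" "x \<in> {p..q}" for p q x
    using that h_const_between[of p q x] by (auto simp: F_def)
  have uF: "u \<in> F" "v \<in> F" using uv by (auto simp: F_def)
  obtain N p q where N: "p \<in> F" "q \<in> F" "p < q"
    "\<And>k x y. N \<le> k \<Longrightarrow> x \<in> {p..q} \<Longrightarrow> y \<in> {p..q} \<Longrightarrow> \<bar>(G ^^ k) x - (G ^^ k) y\<bar> < \<eta>"
  proof (cases "\<forall>x\<in>{u..v}. G x = x")
    case True
    have *: "(G ^^ k) x = x" if "x \<in> {u..v}" for k x
      using funpow_fixed_mult[where f = G and m = 1 and p = x and k = k] True that by simp
    define q where "q = min v (u + \<eta> / 2)"
    have q: "u < q" "q \<le> v" "q - u < \<eta>" using uv \<eta> by (auto simp: q_def)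
    show thesis
    proof (rule that[of u q 0])
      show "q \<in> F" using conv[OF uF, of q] q by simp
      fix k x y assume "x \<in> {u..q}" "y \<in> {u..q}"
      thus "\<bar>(G ^^ k) x - (G ^^ k) y\<bar> < \<eta>" using *[of x k] *[of y k] q by auto
    qed (use uF q in auto)
  next
    case False
    then obtain x where x: "x \<in> {u..v}" "G x \<noteq> x" by blast
    have xF: "x \<in> F" "G x \<in> F" using conv[OF uF x(1)] G_F by auto
    define z where "z k = (G ^^ k) x" for k
    have z_Suc: "z (Suc k) = (G ^^ k) (G x)" for k by (simp add: z_def funpow_swap1)
    have "monoseq z"
    proof (cases "x \<le> G x")
      case True
      hence "z k \<le> z (Suc k)" for k unfolding z_Suc using Gk_mono[OF xF] by (simp add: z_def)
      thus ?thesis by (simp add: monoseq_Suc)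
    next
      case False
      hence "z (Suc k) \<le> z k" for k unfolding z_Suc using Gk_mono[OF xF(2,1)] by (simp add: z_def)
      thus ?thesis by (simp add: monoseq_Suc)
    qed
    moreover have "\<bar>z k\<bar> \<le> 1" for k using Gk_F[OF xF(1), of k] by (auto simp: z_def F_def)
    hence "Bseq z" by (intro BseqI'[of _ 1]) simp
    ultimately have "convergent z" using Bseq_monoseq_convergent by blast
    then obtain l where l: "z \<longlonglongrightarrow> l" by (auto simp: convergent_def)
    have "(\<lambda>k. z (Suc k) - z k) \<longlonglongrightarrow> l - l" by (intro tendsto_diff l LIMSEQ_Suc)
    hence "eventually (\<lambda>k. \<bar>z (Suc k) - z k\<bar> < \<eta>) sequentially"
      using \<eta>(1) by (auto simp: tendsto_iff dist_real_def)
    then obtain N where N: "\<And>k. N \<le> k \<Longrightarrow> \<bar>z (Suc k) - z k\<bar> < \<eta>"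
      by (auto simp: eventually_sequentially)
    \<comment> \<open>The images of the interval between \<open>x\<close> and \<open>G x\<close> are
      bounded by consecutive terms of the convergent sequence \<open>z\<close>.\<close>
    define p q where "p = min x (G x)" and "q = max x (G x)"
    have pq: "p \<in> F" "q \<in> F" "p < q" using xF x by (auto simp: p_def q_def min_def max_def)
    have pqN: "\<bar>(G ^^ k) q - (G ^^ k) p\<bar> < \<eta>" if "N \<le> k" for k
      using N[OF that] by (auto simp: z_def funpow_swap1 p_def q_def min_def max_def)
    show thesis
    proof (rule that[of p q N])
      fix k y y' assume k: "N \<le> k" and y: "y \<in> {p..q}" "y' \<in> {p..q}"
      have "y \<in> F" "y' \<in> F" using conv[OF pq(1,2)] y by auto
      hence "(G ^^ k) p \<le> (G ^^ k) y" "(G ^^ k) y \<le> (G ^^ k) q"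
        "(G ^^ k) p \<le> (G ^^ k) y'" "(G ^^ k) y' \<le> (G ^^ k) q"
        using y pq by (auto intro!: Gk_mono)
      thus "\<bar>(G ^^ k) y - (G ^^ k) y'\<bar> < \<eta>" using pqN[OF k] by linarith
    qed (use pq in auto)
  qed
  show thesis
  proof (rule that[of p q "m * 2 * N"])
    fix n x y assume n: "m * 2 * N \<le> n" and xy: "x \<in> {p..q}" "y \<in> {p..q}"
    define k r where "k = n div (m * 2)" and "r = n mod (m * 2)"
    have "n = r + m * 2 * k" unfolding k_def r_def by (metis add.commute mult_div_mod_eq)
    hence fn: "(f ^^ n) x = (f ^^ r) ((G ^^ k) x)" for x
      by (simp add: G_def funpow_mult funpow_add)
    have k: "N \<le> k" unfolding k_def using n s(2) by (simp add: less_eq_div_iff_mult_less_eq mult.commute)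
    have r: "r < m * 2" unfolding r_def using s(2) by simp
    have "x \<in> F" "y \<in> F" using conv[OF N(1,2)] xy by auto
    hence "(G ^^ k) x \<in> {0..1}" "(G ^^ k) y \<in> {0..1}" using Gk_F by (auto simp: F_def)
    thus "\<bar>(f ^^ n) x - (f ^^ n) y\<bar> < \<delta>" unfolding fn using \<eta>(2)[OF r] N(4)[OF k xy] by blast
  qed (use N in \<open>auto simp: F_def\<close>)
qed

lemma inj_if_sensitive:
  assumes "sensitive_dependence f {0..1}"
  shows "inj_on h {0..1}"
proof (rule ccontr)
  assume "\<not> inj_on h {0..1}"
  then obtain u v where uv: "0 \<le> u" "u < v" "v \<le> 1" "h u = h v" by (rule not_inj_onE)
  define t where "t = h u"
  obtain \<delta> where \<delta>: "0 < \<delta>" and sens: "\<And>x V. x \<in> {0..1} \<Longrightarrow> openin (top_of_set {0..1}) V \<Longrightarrow> x \<in> V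
      \<Longrightarrow> \<exists>y\<in>V. \<exists>n\<ge>1. \<delta> \<le> \<bar>(f ^^ n) x - (f ^^ n) y\<bar>"
    using assms unfolding sensitive_dependence_def by blast
  obtain N p q where pq: "0 \<le> p" "p < q" "q \<le> 1"
    "\<And>n x y. N \<le> n \<Longrightarrow> x \<in> {p..q} \<Longrightarrow> y \<in> {p..q} \<Longrightarrow> \<bar>(f ^^ n) x - (f ^^ n) y\<bar> < \<delta>"
  proof (cases "inj (\<lambda>n. (tent_map ^^ n) t)")
    case True
    define B where "B = {t. \<exists>x\<in>{0..1}. \<exists>y\<in>{0..1}. \<delta> \<le> y - x \<and> h x = t \<and> h y = t}"
    \<comment> \<open>The orbit of \<open>t\<close> never repeats a value, so it meets the finitely
      many long fibers only finitely often.\<close>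
    have "finite ((\<lambda>n. (tent_map ^^ n) t) -` B)"
      unfolding B_def by (intro finite_vimageI finite_long_fibers \<delta> True)
    then obtain N where N: "\<And>n. (tent_map ^^ n) t \<in> B \<Longrightarrow> n < N"
      unfolding finite_nat_set_iff_bounded by auto
    show thesis
    proof (rule that[of u v N])
      fix n x y assume n: "N \<le> n" and xy: "x \<in> {u..v}" "y \<in> {u..v}"
      have xy01: "x \<in> {0..1}" "y \<in> {0..1}" using xy uv by auto
      have "u \<in> {0..1}" "v \<in> {0..1}" using uv by auto
      note const = h_const_between[OF this uv(4)]
      have "h ((f ^^ n) x) = (tent_map ^^ n) t" "h ((f ^^ n) y) = (tent_map ^^ n) t"
        using h_iter[OF xy01(1)] h_iter[OF xy01(2)] const[OF xy(1)] const[OF xy(2)]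
        by (simp_all add: t_def)
      moreover have "(tent_map ^^ n) t \<notin> B" using N[of n] n by fastforce
      ultimately have "\<not> \<delta> \<le> (f ^^ n) x - (f ^^ n) y" "\<not> \<delta> \<le> (f ^^ n) y - (f ^^ n) x"
        using iter_in[OF xy01(1), of n] iter_in[OF xy01(2), of n] unfolding B_def by blast+
      thus "\<bar>(f ^^ n) x - (f ^^ n) y\<bar> < \<delta>" by linarith
    qed (use uv in auto)
  next
    case False
    then obtain i j where "i \<noteq> j" "(tent_map ^^ i) t = (tent_map ^^ j) t" by (auto simp: inj_on_def)
    then obtain i m where im: "1 \<le> m" "(tent_map ^^ (m + i)) t = (tent_map ^^ i) t"
    proof (cases "i < j")
      case True
      thus thesis using that[of "j - i" i] \<open>(tent_map ^^ i) t = (tent_map ^^ j) t\<close> by simp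
    next
      case False
      thus thesis using that[of "i - j" j] \<open>i \<noteq> j\<close> \<open>(tent_map ^^ i) t = (tent_map ^^ j) t\<close> by simp
    qed
    define s where "s = (tent_map ^^ i) t"
    have s: "(tent_map ^^ m) s = s" using im by (simp add: s_def funpow_add)
    \<comment> \<open>Only \<open>t\<close> is known to have a nondegenerate fiber; the property is
      carried along the orbit to the periodic value \<open>s\<close>.\<close>
    obtain u' v' where fiber: "0 \<le> u'" "u' < v'" "v' \<le> 1" "h u' = s" "h v' = s"
      using nondegenerate_fiber_iter[OF uv, of i] by (auto simp: s_def t_def)
    show thesis by (rule periodic_fiber_insensitive[OF s im(1) fiber \<delta>]) (rule that)
  qed
  obtain x V where "x \<in> {0..1}" "openin (top_of_set {0..1}) V" "x \<in> V"
    "\<And>n y. y \<in> V \<Longrightarrow> \<bar>(f ^^ n) x - (f ^^ n) y\<bar> < \<delta>"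
    by (rule insensitive_point[OF pq(1-3) \<delta>]) (rule pq(4), assumption+, rule that)
  with sens[of x V] show False by (meson not_le)
qed

subsection \<open>Consequences of injectivity\<close>


lemma obtain_inverse:
  assumes "inj_on h {0..1}"
  obtains k where "homeomorphism {0..1} {0..1} h k"
  using homeomorphism_compact[OF _ h_cont h_onto assms] by auto

lemma conjugate_if_inj:
  assumes "inj_on h {0..1}"
  shows "topologically_conjugate {0..1} f {0..1} tent_map"
  using obtain_inverse[OF assms] h_f unfolding topologically_conjugate_def by metis

text \<open>Inside any neighborhood the same iterate takes the values 0 and 1, and one of them is at
  least \<open>1/2\<close> away from \<open>(f ^^ n) x\<close>; hence the constant.\<close>

lemma sensitive_if_inj:
  assumes inj: "inj_on h {0..1}"
  shows "sensitive_dependence f {0..1}"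
  unfolding sensitive_dependence_def
proof (intro exI[of _ "1/2"] conjI ballI allI impI)
  fix x V assume x: "x \<in> {0..1}" and V: "openin (top_of_set {0..1::real}) V \<and> x \<in> V"
  then obtain e where e: "0 < e" "\<And>y. y \<in> {0..1} \<Longrightarrow> \<bar>y - x\<bar> < e \<Longrightarrow> y \<in> V"
    unfolding openin_euclidean_subtopology_iff dist_real_def by metis
  define u v where "u = max 0 (x - e / 2)" and "v = min 1 (x + e / 2)"
  have uv: "0 \<le> u" "u < v" "v \<le> 1" "u \<le> x" "x \<le> v" "x - e < u" "v < x + e"
    using x e(1) by (auto simp: u_def v_def)
  have V_sup: "{u..v} \<subseteq> V" using uv by (intro subsetI e(2)) auto
  have "h u \<noteq> h v" using inj_onD[OF inj, of u v] uv by auto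
  hence huv: "h u < h v" using h_mono[of u v] uv by auto
  have "0 \<le> h u" "h v \<le> 1" using h_in[of u] h_in[of v] uv by auto
  then obtain n y z where n: "1 \<le> n" and yz: "y \<in> {h u..h v}" "z \<in> {h u..h v}"
    "(tent_map ^^ n) y = 0" "(tent_map ^^ n) z = 1" by (rule tent_maps_onto[OF _ huv])
  obtain y' where y': "y' \<in> {u..v}" "h y' = y" using h_onto_interval[OF uv(1) less_imp_le[OF uv(2)] uv(3) yz(1)] .
  obtain z' where z': "z' \<in> {u..v}" "h z' = z" using h_onto_interval[OF uv(1) less_imp_le[OF uv(2)] uv(3) yz(2)] .
  have in01: "y' \<in> {0..1}" "z' \<in> {0..1}" using y' z' uv by auto
  have "h ((f ^^ n) y') = h 0" "h ((f ^^ n) z') = h 1"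
    using h_iter[OF in01(1), of n] h_iter[OF in01(2), of n] yz y' z' by (simp_all add: h_0 h_1)
  hence "(f ^^ n) y' = 0" "(f ^^ n) z' = 1"
    using inj_onD[OF inj] iter_in[OF in01(1), of n] iter_in[OF in01(2), of n] by auto
  hence "1/2 \<le> \<bar>(f ^^ n) x - (f ^^ n) y'\<bar> \<or> 1/2 \<le> \<bar>(f ^^ n) x - (f ^^ n) z'\<bar>" by linarith
  thus "\<exists>y\<in>V. \<exists>n\<ge>1. 1/2 \<le> \<bar>(f ^^ n) x - (f ^^ n) y\<bar>" using n y' z' V_sup by blast
qed simp

lemma inverse_iter:
  assumes k: "homeomorphism {0..1} {0..1} h k" and y: "y \<in> {0..1}"
  shows "(f ^^ n) (k y) = k ((tent_map ^^ n) y)"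
proof -
  have ky: "k y \<in> {0..1}" using k y unfolding homeomorphism_def by blast
  have "h ((f ^^ n) (k y)) = (tent_map ^^ n) y"
    using h_iter[OF ky] homeomorphism_apply2[OF k y] by simp
  thus ?thesis using homeomorphism_apply1[OF k iter_in[OF ky]] by metis
qed

lemma dense_periodic_if_inj:
  assumes "inj_on h {0..1}"
  shows "dense_in_set (periodic_points f {0..1}) {0..1}"
  unfolding dense_in_set_def
proof (intro conjI subsetI)
  fix y :: real assume y: "y \<in> {0..1}"
  obtain k where k: "homeomorphism {0..1} {0..1} h k" by (rule obtain_inverse[OF assms])
  have k_in: "k x \<in> {0..1}" if "x \<in> {0..1}" for x using k that unfolding homeomorphism_def by blast
  show "y \<in> closure (periodic_points f {0..1})"
    unfolding closure_approachable
  proof (intro allI impI)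
    fix e :: real assume "0 < e"
    moreover have "continuous_on {0..1} k" using k by (simp add: homeomorphism_def)
    ultimately have "\<exists>d>0. \<forall>x\<in>{0..1}. dist x (h y) < d \<longrightarrow> dist (k x) (k (h y)) < e"
      using h_in[OF y] unfolding continuous_on_iff by blast
    then obtain d where d: "0 < d"
      "\<And>x. x \<in> {0..1} \<Longrightarrow> \<bar>x - h y\<bar> < d \<Longrightarrow> dist (k x) (k (h y)) < e"
      unfolding dist_real_def[of _ "h y"] by blast
    obtain x m where x: "x \<in> {0..1}" "\<bar>x - h y\<bar> < d" "1 \<le> m" "(tent_map ^^ m) x = x"
      using tent_periodic_approx[OF h_in[OF y] d(1)] .
    have "k x \<in> periodic_points f {0..1}"
      using x k_in[OF x(1)] inverse_iter[OF k x(1), of m] by (auto simp: periodic_points_def)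
    moreover have "dist (k x) y < e"
      using d(2)[OF x(1,2)] homeomorphism_apply1[OF k y] by simp
    ultimately show "\<exists>p\<in>periodic_points f {0..1}. dist p y < e" by blast
  qed
qed (simp add: periodic_points_def)

section \<open>The invariant scrambled set\<close>

text \<open>All forward iterates are included for the sake of invariance; in return, pairs with
  equal parameter and different \<open>i\<close> have to be separated too.\<close>

definition scrambled_orbits :: "(real \<Rightarrow> real) \<Rightarrow> real set" where
  "scrambled_orbits k = {(f ^^ i) (k (seed \<alpha>)) | i \<alpha>. \<alpha> \<in> {1..2}}"

context
  fixes k :: "real \<Rightarrow> real"
  assumes k: "homeomorphism {0..1} {0..1} h k"
begin

lemma k_in: "x \<in> {0..1} \<Longrightarrow> k x \<in> {0..1}"
  using k unfolding homeomorphism_def by blast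

lemma k_0: "k 0 = 0" and k_1: "k 1 = 1"
  using homeomorphism_apply1[OF k, of 0] homeomorphism_apply1[OF k, of 1] by (simp_all add: h_0 h_1)

lemma iter_seed_tendsto:
  assumes "(\<lambda>n. (tent_map ^^ \<sigma> n) (seed \<alpha>)) \<longlonglongrightarrow> l" "l \<in> {0..1}"
  shows "(\<lambda>n. (f ^^ \<sigma> n) (k (seed \<alpha>))) \<longlonglongrightarrow> k l"
proof -
  have "continuous_on {0..1} k" using k by (simp add: homeomorphism_def)
  from continuous_on_tendsto_compose[OF this assms]
  show ?thesis using tent_funpow_in[OF seed_in] inverse_iter[OF k seed_in] by simp
qed

lemma scrambled_orbits_transitive:
  "scrambled_orbits k \<subseteq> transitive_points f {0..1}"
proof
  fix x assume "x \<in> scrambled_orbits k"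
  then obtain i \<alpha> where \<alpha>: "\<alpha> \<in> {1..2}" and x: "x = (f ^^ i) (k (seed \<alpha>))"
    by (auto simp: scrambled_orbits_def)
  have x01: "x \<in> {0..1}" unfolding x by (intro iter_in k_in seed_in)
  have "y \<in> closure (orbit_of f x)" if y: "y \<in> {0..1}" for y
  proof -
    obtain \<sigma> where \<sigma>: "filterlim \<sigma> at_top sequentially"
      "(\<lambda>n. (tent_map ^^ \<sigma> n) (seed \<alpha>)) \<longlonglongrightarrow> h y" using seed_transitive[OF \<alpha> h_in[OF y]] .
    have lim: "(\<lambda>n. (f ^^ \<sigma> n) (k (seed \<alpha>))) \<longlonglongrightarrow> y"
      using iter_seed_tendsto[OF \<sigma>(2) h_in[OF y]] homeomorphism_apply1[OF k y] by simp
    have "eventually (\<lambda>n. i \<le> \<sigma> n) sequentially" using \<sigma>(1) by (simp add: filterlim_at_top)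
    hence "eventually (\<lambda>n. (f ^^ \<sigma> n) (k (seed \<alpha>)) = (f ^^ (\<sigma> n - i)) x) sequentially"
    proof eventually_elim
      case (elim n)
      thus ?case unfolding x by (metis comp_apply funpow_add le_add_diff_inverse2)
    qed
    from Lim_transform_eventually[OF lim this]
    have "(\<lambda>n. (f ^^ (\<sigma> n - i)) x) \<longlonglongrightarrow> y" .
    moreover have "(f ^^ (\<sigma> n - i)) x \<in> orbit_of f x" for n by (auto simp: orbit_of_def)
    ultimately show ?thesis unfolding closure_sequential by (intro exI conjI) auto
  qed
  moreover have "orbit_of f x \<subseteq> {0..1}" using iter_in[OF x01] unfolding orbit_of_def by blast
  ultimately show "x \<in> transitive_points f {0..1}"
    using x01 by (auto simp: transitive_points_def dense_in_set_def)
qed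

lemma scrambled_orbits_invariant: "invariant_set f (scrambled_orbits k)"
proof -
  have "f ((f ^^ i) y) = (f ^^ Suc i) y" for i y by simp
  thus ?thesis unfolding invariant_set_def scrambled_orbits_def by blast
qed

lemma scrambled_orbits_subset: "scrambled_orbits k \<subseteq> {0..1}"
  using scrambled_orbits_transitive by (auto simp: transitive_points_def)

lemma scrambled_orbits_dense: "dense_in_set (scrambled_orbits k) {0..1}"
proof -
  have "k (seed 1) \<in> scrambled_orbits k"
    unfolding scrambled_orbits_def mem_Collect_eq by (rule exI[of _ 0], rule exI[of _ 1]) simp
  hence "{0..1} \<subseteq> closure (orbit_of f (k (seed 1)))"
    using scrambled_orbits_transitive by (auto simp: transitive_points_def dense_in_set_def)
  moreover have "orbit_of f (k (seed 1)) \<subseteq> scrambled_orbits k"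
    unfolding orbit_of_def scrambled_orbits_def by (force intro: exI[of _ 1])
  ultimately show ?thesis
    using scrambled_orbits_subset closure_mono unfolding dense_in_set_def by blast
qed

lemma limsup_pair_ordered:
  assumes "\<alpha> \<in> {1..2}" "\<beta> \<in> {1..2}" "\<alpha> < \<beta> \<or> \<alpha> = \<beta> \<and> i < j"
  shows "limsup (\<lambda>n. ereal \<bar>(f ^^ n) ((f ^^ i) (k (seed \<beta>))) - (f ^^ n) ((f ^^ j) (k (seed \<alpha>)))\<bar>) \<ge> 1"
proof -
  obtain \<sigma> where \<sigma>: "filterlim \<sigma> at_top sequentially"
    and 1: "(\<lambda>n. (tent_map ^^ (\<sigma> n + i)) (seed \<beta>)) \<longlonglongrightarrow> 1"
    and 0: "(\<lambda>n. (tent_map ^^ (\<sigma> n + j)) (seed \<alpha>)) \<longlonglongrightarrow> 0"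
    using seed_separated[OF assms] .
  have "(\<lambda>n. \<bar>(f ^^ (\<sigma> n + i)) (k (seed \<beta>)) - (f ^^ (\<sigma> n + j)) (k (seed \<alpha>))\<bar>) \<longlonglongrightarrow> \<bar>k 1 - k 0\<bar>"
    by (intro tendsto_intros iter_seed_tendsto 0 1) auto
  hence "(\<lambda>n. \<bar>(f ^^ \<sigma> n) ((f ^^ i) (k (seed \<beta>))) - (f ^^ \<sigma> n) ((f ^^ j) (k (seed \<alpha>)))\<bar>) \<longlonglongrightarrow> 1"
    by (simp add: k_0 k_1 funpow_add)
  from limsup_ge_subseq[OF \<sigma> this, of "\<lambda>n. \<bar>(f ^^ n) ((f ^^ i) (k (seed \<beta>))) - (f ^^ n) ((f ^^ j) (k (seed \<alpha>)))\<bar>"]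
  show ?thesis by (simp add: one_ereal_def)
qed

lemma limsup_pair:
  assumes "\<alpha> \<in> {1..2}" "\<beta> \<in> {1..2}" "(\<alpha>, i) \<noteq> (\<beta>, j)"
  shows "limsup (\<lambda>n. ereal \<bar>(f ^^ n) ((f ^^ i) (k (seed \<alpha>))) - (f ^^ n) ((f ^^ j) (k (seed \<beta>)))\<bar>) \<ge> 1"
proof -
  consider "\<alpha> < \<beta> \<or> \<alpha> = \<beta> \<and> j < i" | "\<beta> < \<alpha> \<or> \<beta> = \<alpha> \<and> i < j" using assms(3) by fastforce
  thus ?thesis
    by cases (use limsup_pair_ordered[of \<alpha> \<beta> j i] limsup_pair_ordered[of \<beta> \<alpha> i j] assms
      in \<open>simp_all add: abs_minus_commute del: atLeastAtMost_iff\<close>)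
qed

lemma iter_zero_time:
  assumes "x \<in> scrambled_orbits k"
  shows "(\<lambda>n. (f ^^ (zero_time n + l)) x) \<longlonglongrightarrow> 0"
proof -
  obtain i \<alpha> where \<alpha>: "\<alpha> \<in> {1..2}" and x: "x = (f ^^ i) (k (seed \<alpha>))"
    using assms by (auto simp: scrambled_orbits_def)
  have "(\<lambda>n. (tent_map ^^ (zero_time n + (l + i))) (seed \<alpha>)) \<longlonglongrightarrow> 0"
    using seed_common_zero[OF \<alpha>] by (simp add: zero_time_def)
  from iter_seed_tendsto[OF this] show ?thesis by (simp add: x k_0 funpow_add)
qed

lemma iter_one_time:
  assumes "x \<in> scrambled_orbits k"
  obtains \<sigma> where "filterlim \<sigma> at_top sequentially" "(\<lambda>n. (f ^^ \<sigma> n) x) \<longlonglongrightarrow> 1"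
proof -
  obtain i \<alpha> where \<alpha>: "\<alpha> \<in> {1..2}" and x: "x = (f ^^ i) (k (seed \<alpha>))"
    using assms by (auto simp: scrambled_orbits_def)
  obtain \<sigma> where \<sigma>: "filterlim \<sigma> at_top sequentially"
    "(\<lambda>n. (tent_map ^^ (\<sigma> n + i)) (seed \<alpha>)) \<longlonglongrightarrow> 1"
    \<comment> \<open>Pairing the orbit with its own next shift meets the ordering condition; only
      the limit 1 is wanted.\<close>
    using seed_separated[OF \<alpha> \<alpha>, of i "Suc i"] by auto
  from iter_seed_tendsto[OF \<sigma>(2)] have "(\<lambda>n. (f ^^ \<sigma> n) x) \<longlonglongrightarrow> 1" by (simp add: x k_1 funpow_add)
  with \<sigma>(1) show thesis by (rule that)
qed

lemma uncountable_scrambled_orbits: "uncountable (scrambled_orbits k)"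
proof
  have "inj_on (\<lambda>\<alpha>. k (seed \<alpha>)) {1..2}"
  proof (rule inj_onI)
    fix \<alpha> \<beta> :: real assume *: "\<alpha> \<in> {1..2}" "\<beta> \<in> {1..2}" "k (seed \<alpha>) = k (seed \<beta>)"
    show "\<alpha> = \<beta>"
    proof (rule ccontr)
      assume "\<alpha> \<noteq> \<beta>"
      \<comment> \<open>If the two points coincided, their distances would all be 0, against an
        upper limit of at least 1.\<close>
      hence "(\<alpha>, 0) \<noteq> (\<beta>, 0::nat)" by simp
      from limsup_pair[OF *(1,2) this] *(3) show False by (simp add: Limsup_const zero_ereal_def[symmetric])
    qed
  qed
  moreover assume "countable (scrambled_orbits k)"
  moreover have "k (seed \<alpha>) \<in> scrambled_orbits k" if "\<alpha> \<in> {1..2}" for \<alpha>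
    unfolding scrambled_orbits_def mem_Collect_eq
    by (rule exI[of _ 0], rule exI[of _ \<alpha>]) (use that in simp)
  hence "(\<lambda>\<alpha>. k (seed \<alpha>)) ` {1..2} \<subseteq> scrambled_orbits k" by blast
  ultimately have "countable {1..2::real}" using countable_image_inj_on countable_subset by blast
  thus False using uncountable_closed_interval[of 1 2] by simp
qed

lemma limsup_periodic_ge_point:
  assumes x: "x \<in> scrambled_orbits k" and p: "p \<in> {0..1}" "(f ^^ m) p = p" "1 \<le> m"
  shows "limsup (\<lambda>n. ereal \<bar>(f ^^ n) x - (f ^^ n) p\<bar>) \<ge> ereal ((f ^^ j) p)"
proof -
  \<comment> \<open>The correction is below \<open>m\<close> and makes \<open>\<sigma> n\<close>
    congruent to \<open>j\<close> modulo \<open>m\<close>; the factor \<open>m - 1\<close> stands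
    for \<open>-1\<close>, avoiding subtraction of naturals.\<close>
  define \<sigma> where "\<sigma> n = zero_time n + (j + (m - 1) * zero_time n) mod m" for n
  \<comment> \<open>The correction varies with \<open>n\<close>, so the iterate of \<open>x\<close>
    is bounded by the sum over all \<open>m\<close> possible ones, each of which tends to 0.\<close>
  define v where "v n = (f ^^ j) p - (\<Sum>l<m. (f ^^ (zero_time n + l)) x)" for n
  have "v \<longlonglongrightarrow> (f ^^ j) p - (\<Sum>l<m. 0)"
    unfolding v_def by (intro tendsto_intros iter_zero_time x)
  hence v: "v \<longlonglongrightarrow> (f ^^ j) p" by simp
  have x01: "x \<in> {0..1}" using x scrambled_orbits_subset by blast
  have "v n \<le> \<bar>(f ^^ \<sigma> n) x - (f ^^ \<sigma> n) p\<bar>" for n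
  proof -
    have "\<sigma> n mod m = (zero_time n + (j + (m - 1) * zero_time n)) mod m"
      unfolding \<sigma>_def by (rule mod_add_right_eq)
    also have "zero_time n + (j + (m - 1) * zero_time n) = j + m * zero_time n"
      using p(3) by (cases m) simp_all
    finally have "(f ^^ \<sigma> n) p = (f ^^ j) p"
      using funpow_mod_eq[OF p(2), of "\<sigma> n"] funpow_mod_eq[OF p(2), of j] by simp
    moreover have "(f ^^ \<sigma> n) x \<le> (\<Sum>l<m. (f ^^ (zero_time n + l)) x)"
      unfolding \<sigma>_def
      by (rule member_le_sum[where f = "\<lambda>l. (f ^^ (zero_time n + l)) x"])
        (use p(3) iter_in[OF x01] in auto)
    ultimately show ?thesis by (simp add: v_def)
  qed
  moreover have "filterlim \<sigma> at_top sequentially" unfolding \<sigma>_def by (rule filterlim_zero_time)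
  ultimately show ?thesis by (intro limsup_ge_subseq[OF _ v])
qed

lemma limsup_periodic:
  assumes x: "x \<in> scrambled_orbits k" and p: "p \<in> periodic_points f {0..1}"
  shows "limsup (\<lambda>n. ereal \<bar>(f ^^ n) x - (f ^^ n) p\<bar>) \<ge> ereal (1 / 2)"
proof -
  obtain m where p01: "p \<in> {0..1}" and m: "(f ^^ m) p = p" "1 \<le> m"
    using p by (auto simp: periodic_points_def)
  show ?thesis
  proof (cases "\<exists>j. 1/2 \<le> (f ^^ j) p")
    case True
    then obtain j where "ereal (1/2) \<le> ereal ((f ^^ j) p)" by auto
    also note limsup_periodic_ge_point[OF x p01 m]
    finally show ?thesis .
  next
    case False
    obtain \<sigma> where \<sigma>: "filterlim \<sigma> at_top sequentially" "(\<lambda>n. (f ^^ \<sigma> n) x) \<longlonglongrightarrow> 1"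
      using iter_one_time[OF x] .
    have "(\<lambda>n. (f ^^ \<sigma> n) x - 1/2) \<longlonglongrightarrow> 1 - 1/2" by (intro tendsto_intros \<sigma>)
    hence "(\<lambda>n. (f ^^ \<sigma> n) x - 1/2) \<longlonglongrightarrow> 1/2" by simp
    with \<sigma>(1) show ?thesis
    proof (rule limsup_ge_subseq)
      fix n
      have "(f ^^ \<sigma> n) p < 1/2" using False by (simp add: not_le)
      thus "(f ^^ \<sigma> n) x - 1/2 \<le> \<bar>(f ^^ \<sigma> n) x - (f ^^ \<sigma> n) p\<bar>" by linarith
    qed
  qed
qed

lemma liminf_pair:
  assumes "x \<in> scrambled_orbits k" "y \<in> scrambled_orbits k"
  shows "liminf (\<lambda>n. ereal \<bar>(f ^^ n) x - (f ^^ n) y\<bar>) = 0"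
proof (rule antisym)
  have "(\<lambda>n. \<bar>(f ^^ (zero_time n + 0)) x - (f ^^ (zero_time n + 0)) y\<bar>) \<longlonglongrightarrow> \<bar>0 - 0\<bar>"
    by (intro tendsto_intros iter_zero_time assms)
  from liminf_le_subseq[OF filterlim_zero_time this]
  show "liminf (\<lambda>n. ereal \<bar>(f ^^ n) x - (f ^^ n) y\<bar>) \<le> 0" by (simp add: zero_ereal_def)
  show "0 \<le> liminf (\<lambda>n. ereal \<bar>(f ^^ n) x - (f ^^ n) y\<bar>)"
    by (intro Liminf_bounded always_eventually) simp
qed

lemma scrambled_orbits_scrambled: "scrambled_set 1 f (scrambled_orbits k)"
  unfolding scrambled_set_def
proof (intro conjI ballI impI)
  fix x y assume xy: "x \<in> scrambled_orbits k" "y \<in> scrambled_orbits k" "x \<noteq> y"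
  then obtain i j \<alpha> \<beta> where *: "\<alpha> \<in> {1..2}" "\<beta> \<in> {1..2}"
    "x = (f ^^ i) (k (seed \<alpha>))" "y = (f ^^ j) (k (seed \<beta>))"
    by (auto simp: scrambled_orbits_def)
  hence "(\<alpha>, i) \<noteq> (\<beta>, j)" using xy(3) by auto
  from limsup_pair[OF *(1,2) this]
  show "ereal 1 \<le> limsup (\<lambda>n. ereal \<bar>(f ^^ n) x - (f ^^ n) y\<bar>)" by (simp add: * one_ereal_def)
qed (use scrambled_orbits_subset uncountable_scrambled_orbits limsup_periodic liminf_pair in auto)

end

lemma dense_orbit_if_inj:
  assumes "inj_on h {0..1}"
  shows "has_dense_orbit f {0..1}"
proof -
  obtain k where k: "homeomorphism {0..1} {0..1} h k" by (rule obtain_inverse[OF assms])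
  have "scrambled_orbits k \<noteq> {}" using uncountable_scrambled_orbits[OF k] by auto
  thus ?thesis using scrambled_orbits_transitive[OF k]
    by (auto simp: transitive_points_def has_dense_orbit_def)
qed

end

theorem theorem2:
  fixes f :: "real \<Rightarrow> real" and a :: real
  assumes "0 < a" and "a < 1"
    and "continuous_on {0..1} f" and "f ` {0..1} = {0..1}"
    and "f 0 = 0" and "f 1 = 0" and "f a = 1"
    and "strict_mono_on {0..a} f"
    and "strict_antimono_on {a..1} f"
  shows "(has_dense_orbit f {0..1} \<longleftrightarrow> dense_in_set (periodic_points f {0..1}) {0..1}) \<and>
    (dense_in_set (periodic_points f {0..1}) {0..1} \<longleftrightarrow> sensitive_dependence f {0..1}) \<and>
    (has_dense_orbit f {0..1} \<longrightarrow>
      topologically_conjugate {0..1} f {0..1} tent_map \<and>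
      (\<exists>S. dense_in_set S {0..1} \<and> uncountable S \<and> invariant_set f S \<and>
        scrambled_set 1 f S \<and> S \<subseteq> transitive_points f {0..1}))"
proof -
  interpret full_unimodal f a by standard (fact assms)+
  have "has_dense_orbit f {0..1} \<longleftrightarrow> inj_on h {0..1}"
    using inj_if_dense_orbit dense_orbit_if_inj by blast
  moreover have "dense_in_set (periodic_points f {0..1}) {0..1} \<longleftrightarrow> inj_on h {0..1}"
    using inj_if_dense_periodic dense_periodic_if_inj by blast
  moreover have "sensitive_dependence f {0..1} \<longleftrightarrow> inj_on h {0..1}"
    using inj_if_sensitive sensitive_if_inj by blast
  moreover have "\<exists>S. dense_in_set S {0..1} \<and> uncountable S \<and> invariant_set f S \<and>
      scrambled_set 1 f S \<and> S \<subseteq> transitive_points f {0..1}" if inj: "inj_on h {0..1}"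
  proof -
    obtain k where k: "homeomorphism {0..1} {0..1} h k" by (rule obtain_inverse[OF inj])
    show ?thesis
      by (intro exI[of _ "scrambled_orbits k"] conjI scrambled_orbits_dense[OF k]
          uncountable_scrambled_orbits[OF k] scrambled_orbits_invariant[OF k]
          scrambled_orbits_scrambled[OF k] scrambled_orbits_transitive[OF k])
  qed
  ultimately show ?thesis using conjugate_if_inj by simp
qed

end
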